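(* Let $T>0$, $\sigma>0$, $\mu,r,b\in\mathbb{R}$ be constants, and put $\theta:=\frac{\mu-r}{\sigma}$. For a constant portfolio $\pi\in\mathbb{R}$ let $X^\pi$ be the solution of the Skorokhod stochastic differential equation $$\delta X_t=\Big[(1-\pi)r+\pi\mu+\pi\sigma\frac{b-W_T}{T}\Big]X_t\,dt+\pi\sigma X_t\,\delta W_t,\qquad X_0\in(0,\infty)\text{ constant},\quad t\in[0,T].$$ Then $V_T^\pi:=\mathbb{E}[\log(X_T^\pi/X_0)]=rT+(\mu-r)\pi T+\sigma b\pi$. Under the no-shorting constraint $\pi\in[0,1]$, an optimal portfolio maximizing $V_T^\pi$ is $$\pi^*=\mathbb{I}_{\{b>-\theta T\}},$$ and the corresponding value is $$V_T^{\pi^*}=rT+(\theta\sigma T+\sigma b)\,\mathbb{I}_{\{b>-\theta T\}}.$$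
   Context: $W=(W_t)_{t\in[0,T]}$ is a standard Brownian motion on Wiener space, and $\delta W$ denotes Skorokhod integration (the adjoint $\delta$ of the Malliavin derivative). A solution is a process $X$ with $\mathbb{I}_{[0,t]}\pi\sigma X\in\mathrm{Dom}(\delta)$ and, almost surely, $\int_0^t\pi\sigma X_s\,\delta W_s=X_t-X_0-\int_0^t\big[(1-\pi)r+\pi\mu+\pi\sigma\frac{b-W_T}{T}\big]X_s\,ds$ for $0\le t\le T$. The unique solution is $X_t=X_0\exp\big\{\pi\sigma W_t+[(1-\pi)r+\pi\mu+\pi\sigma\frac{b-W_T}{T}-\frac12\pi^2\sigma^2]t+\frac{1}{2T}\pi^2\sigma^2t^2\big\}$. When $b=-\theta T$ every $\pi$ gives the same value, and $\pi^*=0$ is chosen by convention. *)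

theory Defs
  imports "HOL-Probability.Probability"
begin

text \<open>
  A standard Brownian motion \<open>W\<close> on \<open>{0..T}\<close> over a probability space whose events are exactly
  those generated by \<open>W\<close>, up to null sets. Both the raw and the completed \<open>\<sigma>\<close>-algebra are
  covered; canonical Wiener space with its coordinate process is an instance.
\<close>

locale wiener_space = prob_space M for M :: "'a measure" +
  fixes T :: real and W :: "real \<Rightarrow> 'a \<Rightarrow> real"
  assumes T_pos: "0 < T"
    and W_measurable: "\<And>t. t \<in> {0..T} \<Longrightarrow> W t \<in> borel_measurable M"
    and W_start: "AE \<omega> in M. W 0 \<omega> = 0"
    and W_normal: "\<And>s t. 0 \<le> s \<Longrightarrow> s < t \<Longrightarrow> t \<le> T \<Longrightarrow>
      distributed M lborel (\<lambda>\<omega>. W t \<omega> - W s \<omega>) (normal_density 0 (sqrt (t - s)))"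
    and W_indep_increments: "\<And>(n::nat) \<tau>. (\<And>i. i \<le> n \<Longrightarrow> \<tau> i \<in> {0..T}) \<Longrightarrow> mono_on {..n} \<tau> \<Longrightarrow>
      indep_vars (\<lambda>_. borel) (\<lambda>i \<omega>. W (\<tau> (Suc i)) \<omega> - W (\<tau> i) \<omega>) {..<n}"
    and W_continuous: "AE \<omega> in M. continuous_on {0..T} (\<lambda>t. W t \<omega>)"
    and W_generates: "\<And>A. A \<in> sets M \<Longrightarrow>
      \<exists>B\<in>sigma_sets (space M) {W t -` S \<inter> space M | t S. t \<in> {0..T} \<and> S \<in> sets borel}.
        AE \<omega> in M. \<omega> \<in> A \<longleftrightarrow> \<omega> \<in> B"

definition square_integrable :: "'b measure \<Rightarrow> ('b \<Rightarrow> real) \<Rightarrow> bool" where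
  "square_integrable N f \<longleftrightarrow> f \<in> borel_measurable N \<and> integrable N (\<lambda>x. (f x)\<^sup>2)"

definition time_space :: "'a measure \<Rightarrow> real \<Rightarrow> (real \<times> 'a) measure" where
  "time_space M T = restrict_space lborel {0..T} \<Otimes>\<^sub>M M"

text \<open>
  Functions on \<open>n\<close>-dimensional space, with \<open>n\<close> varying, are functions on the lists of length \<open>n\<close>.
  \<open>smooth_poly_growth n\<close> says that all iterated partial derivatives exist and have polynomial
  growth. They are then locally bounded, so each of them is locally Lipschitz: joint continuity,
  hence smoothness in the usual sense, is automatic.
\<close>

definition partial :: "nat \<Rightarrow> (real list \<Rightarrow> real) \<Rightarrow> real list \<Rightarrow> real" where
  "partial i f xs = deriv (\<lambda>y. f (xs[i := y])) (xs ! i)"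

definition smooth_poly_growth :: "nat \<Rightarrow> (real list \<Rightarrow> real) \<Rightarrow> bool" where
  "smooth_poly_growth n f \<longleftrightarrow>
    (\<forall>\<alpha>. set \<alpha> \<subseteq> {..<n} \<longrightarrow>
      (\<forall>xs i. length xs = n \<longrightarrow> i < n \<longrightarrow>
        (\<lambda>y. foldr partial \<alpha> f (xs[i := y])) field_differentiable (at (xs ! i))) \<and>
      (\<exists>C k. \<forall>xs. length xs = n \<longrightarrow>
        \<bar>foldr partial \<alpha> f xs\<bar> \<le> C * (1 + (\<Sum>i<n. \<bar>xs ! i\<bar>)) ^ k))"

text \<open>
  Malliavin derivative of a smooth cylindrical variable \<open>f (W t\<^sub>1, \<dots>, W t\<^sub>n)\<close>. The closure below
  is the same if \<open>W t\<^sub>i\<close> is replaced by a Wiener integral of a general square integrable function.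
\<close>

definition smooth_malliavin ::
  "real \<Rightarrow> (real \<Rightarrow> 'a \<Rightarrow> real) \<Rightarrow> ('a \<Rightarrow> real) \<Rightarrow> (real \<Rightarrow> 'a \<Rightarrow> real) \<Rightarrow> bool" where
  "smooth_malliavin T W F DF \<longleftrightarrow>
    (\<exists>ts f. set ts \<subseteq> {0..T} \<and> smooth_poly_growth (length ts) f \<and>
      F = (\<lambda>\<omega>. f (map (\<lambda>t. W t \<omega>) ts)) \<and>
      DF = (\<lambda>s \<omega>. \<Sum>i<length ts. partial i f (map (\<lambda>t. W t \<omega>) ts) * indicator {0..ts ! i} s))"

text \<open>
  Graph of the closure of the derivative as an operator from square integrable random variables to
  square integrable processes: \<open>F\<close> lies in its domain and \<open>DF\<close> is (a version of) its derivative.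
\<close>

definition malliavin_derivative ::
  "'a measure \<Rightarrow> real \<Rightarrow> (real \<Rightarrow> 'a \<Rightarrow> real) \<Rightarrow> ('a \<Rightarrow> real) \<Rightarrow> (real \<Rightarrow> 'a \<Rightarrow> real) \<Rightarrow> bool" where
  "malliavin_derivative M T W F DF \<longleftrightarrow>
    square_integrable M F \<and>
    square_integrable (time_space M T) (\<lambda>(s, \<omega>). DF s \<omega>) \<and>
    (\<exists>G DG. (\<forall>n::nat. smooth_malliavin T W (G n) (DG n)) \<and>
      (\<lambda>n. \<integral>\<omega>. (G n \<omega> - F \<omega>)\<^sup>2 \<partial>M) \<longlonglongrightarrow> 0 \<and>
      (\<lambda>n. \<integral>(s, \<omega>). (DG n s \<omega> - DF s \<omega>)\<^sup>2 \<partial>time_space M T) \<longlonglongrightarrow> 0)"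

text \<open>
  Graph of the adjoint of the Malliavin derivative: \<open>u\<close> is in the domain of the Skorokhod integral
  iff such a \<open>Z\<close> exists, and \<open>Z\<close> is then (a version of) the Skorokhod integral of \<open>u\<close>.
\<close>

definition skorokhod_integral ::
  "'a measure \<Rightarrow> real \<Rightarrow> (real \<Rightarrow> 'a \<Rightarrow> real) \<Rightarrow> (real \<Rightarrow> 'a \<Rightarrow> real) \<Rightarrow> ('a \<Rightarrow> real) \<Rightarrow> bool" where
  "skorokhod_integral M T W u Z \<longleftrightarrow>
    square_integrable (time_space M T) (\<lambda>(s, \<omega>). u s \<omega>) \<and>
    square_integrable M Z \<and>
    (\<forall>F DF. malliavin_derivative M T W F DF \<longrightarrow>
      (\<integral>(s, \<omega>). DF s \<omega> * u s \<omega> \<partial>time_space M T) = (\<integral>\<omega>. F \<omega> * Z \<omega> \<partial>M))"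

text \<open>
  \<open>X\<close> solves \<open>\<delta>X = a X dt + c X \<delta>W\<close>, \<open>X 0 = x0\<close>, with random, possibly anticipating, \<open>a\<close>.
  \<open>Z t\<close> is the indefinite Skorokhod integral of \<open>c X\<close>, determined for each \<open>t\<close> up to a null set.
\<close>

definition skorokhod_sde_solution ::
  "'a measure \<Rightarrow> real \<Rightarrow> (real \<Rightarrow> 'a \<Rightarrow> real) \<Rightarrow> real \<Rightarrow> ('a \<Rightarrow> real) \<Rightarrow> real \<Rightarrow>
    (real \<Rightarrow> 'a \<Rightarrow> real) \<Rightarrow> bool" where
  "skorokhod_sde_solution M T W x0 a c X \<longleftrightarrow>
    (\<lambda>(s, \<omega>). X s \<omega>) \<in> borel_measurable (time_space M T) \<and>
    (AE \<omega> in M. X 0 \<omega> = x0) \<and>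
    (AE \<omega> in M. set_integrable lborel {0..T} (\<lambda>s. a \<omega> * X s \<omega>)) \<and>
    (\<exists>Z. (\<forall>t\<in>{0..T}.
            skorokhod_integral M T W (\<lambda>s \<omega>. indicator {0..t} s * (c * X s \<omega>)) (Z t)) \<and>
         (AE \<omega> in M. \<forall>t\<in>{0..T}.
            Z t \<omega> = X t \<omega> - X 0 \<omega> - (LINT s:{0..t}|lborel. a \<omega> * X s \<omega>)))"

definition wealth_solution ::
  "'a measure \<Rightarrow> real \<Rightarrow> (real \<Rightarrow> 'a \<Rightarrow> real) \<Rightarrow> real \<Rightarrow> real \<Rightarrow> real \<Rightarrow> real \<Rightarrow> real \<Rightarrow> real \<Rightarrow>
    (real \<Rightarrow> 'a \<Rightarrow> real) \<Rightarrow> bool" where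
  "wealth_solution M T W \<mu> r \<sigma> b x0 p X \<longleftrightarrow>
    skorokhod_sde_solution M T W x0
      (\<lambda>\<omega>. (1 - p) * r + p * \<mu> + p * \<sigma> * ((b - W T \<omega>) / T)) (p * \<sigma>) X"

end

theory Submission
  imports Defs
begin

text \<open>
  Put \<open>c = p \<sigma>\<close>, so that the drift coefficient is \<open>A - (c/T) W\<^sub>T\<close> with a constant \<open>A\<close>. Testing the
  equation with \<open>W\<^sub>T^j exp(\<i>L)\<close>, where \<open>L = \<Sum>\<^sub>l k\<^sub>l W(t\<^sub>l)\<close> and \<open>K\<close> is its Malliavin derivative, turns
  the duality between \<open>\<delta>\<close> and the Malliavin derivative into a hierarchy of equations
  \<open>m\<^sub>j' = A m\<^sub>j - (c/T) m\<^sub>j\<^sub>+\<^sub>1 + c j m\<^sub>j\<^sub>-\<^sub>1 + \<i> c K m\<^sub>j\<close> for the moments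
  \<open>m\<^sub>j(t) = E[W\<^sub>T^j exp(\<i>L) X\<^sub>t]\<close>. The generating function \<open>\<Sum>\<^sub>j \<lambda>^j/j! m\<^sub>j(t)\<close> solves a transport equation
  with real characteristics \<open>\<lambda>(t) = (c/T)(t - T) + const\<close>. Along the characteristic ending in \<open>\<lambda>(T) = 0\<close>
  it becomes a scalar linear equation that determines \<open>E[exp(\<i>L) X\<^sub>T]\<close> by the Gaussian integral
  \<open>E[exp(-c W\<^sub>T + \<i>L)]\<close>; the result is \<open>x0 exp(A T) E[exp(\<i>L)]\<close>. Since the variables \<open>exp(\<i>L)\<close> are
  total, \<open>X\<^sub>T = x0 exp(A T)\<close> almost surely: the terminal wealth is deterministic.

  If \<open>c = 0\<close> then the equation does not force \<open>X\<close> to be square integrable, but the Skorokhod integral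
  vanishes and \<open>X\<close> solves a linear equation pathwise.
\<close>

text \<open>An arbitrary solution is treated, without an explicit formula or a uniqueness theorem.
  The obstacle is that the drift anticipates \<open>W T\<close>: testing with exp(iL) alone brings
  in E[W_T exp(iL) X_t], then the second power of \<open>W T\<close>, and so on, so the hierarchy
  closes at no finite order. Moreover \<open>X\<close> is controlled only over time and probability
  jointly, through the domain of the Skorokhod integral. Hence the infinite generating function is
  never differentiated; a finite truncation is, and its error is estimated after integration over
  time. The characteristic starts at \<open>\<lambda>(0) = -c\<close>. As X_0 is constant, the
  generating function there is x0 E[exp(-c W_T + iL)], which is where the Gaussian integral comes
  from. Transport to time T multiplies by exp(A T - c^2 T/2 + i c S) with S the sum of the
  \<open>k_l t_l\<close>, while tilting the Gaussian integral yields exp(c^2 T/2 - i c S)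
  E[exp(iL)]. Everything but exp(A T) cancels.\<close>

section \<open>Totality of trigonometric functions of Brownian motion\<close>

text \<open>The positive and negative parts of \<open>g\<close> have the same mass (the case
  \<open>u = 0\<close>). If it is positive, both are normalised to probability densities; the two
  image laws under \<open>V\<close> share their characteristic function, so Levy's uniqueness
  theorem identifies them. Mass zero means that \<open>g\<close> vanishes almost everywhere.\<close>

lemma fourier_zero_real:
  fixes g V :: "'a \<Rightarrow> real"
  assumes g: "integrable M g" and V[measurable]: "V \<in> borel_measurable M"
    and zero: "\<And>u. (\<integral>x. of_real (g x) * cis (u * V x) \<partial>M) = 0"
    and B[measurable]: "B \<in> sets borel"
  shows "(\<integral>x. g x * indicator B (V x) \<partial>M) = 0"
proof -
  note [measurable] = borel_measurable_integrable[OF g]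
  define gp where "gp x = max 0 (g x)" for x
  define gm where "gm x = max 0 (- g x)" for x
  have [measurable]: "gp \<in> borel_measurable M" "gm \<in> borel_measurable M"
    unfolding gp_def gm_def by measurable
  have gp: "integrable M gp" and gm: "integrable M gm"
    unfolding gp_def gm_def using g by auto
  have split: "g x = gp x - gm x" for x
    by (auto simp: gp_def gm_def)
  have nn: "gp x \<ge> 0" "gm x \<ge> 0" for x
    by (auto simp: gp_def gm_def)
  have bdd: "integrable M (\<lambda>x. of_real (h x) * cis (u * V x))" if "integrable M h" for h :: "'a \<Rightarrow> real" and u
  proof (rule Bochner_Integration.integrable_bound[OF that])
    show "(\<lambda>x. complex_of_real (h x) * cis (u * V x)) \<in> borel_measurable M"
      using borel_measurable_integrable[OF that] unfolding cis_conv_exp by measurable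
  qed (auto simp: norm_mult)
  have eq: "(\<integral>x. of_real (gp x) * cis (u * V x) \<partial>M) = (\<integral>x. of_real (gm x) * cis (u * V x) \<partial>M)" for u
  proof -
    have "(\<integral>x. of_real (g x) * cis (u * V x) \<partial>M) =
      (\<integral>x. of_real (gp x) * cis (u * V x) - of_real (gm x) * cis (u * V x) \<partial>M)"
      by (simp add: split ring_distribs)
    also have "\<dots> = (\<integral>x. of_real (gp x) * cis (u * V x) \<partial>M) - (\<integral>x. of_real (gm x) * cis (u * V x) \<partial>M)"
      by (rule Bochner_Integration.integral_diff) (intro bdd gp gm)+
    finally show ?thesis using zero by simp
  qed
  define m where "m = (\<integral>x. gp x \<partial>M)"
  have m: "(\<integral>x. gm x \<partial>M) = m"
    using eq[of 0] by (simp add: m_def)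
  have m_nn: "m \<ge> 0" unfolding m_def using nn by simp
  show ?thesis
  proof (cases "m = 0")
    case True
    then have "AE x in M. gp x = 0" "AE x in M. gm x = 0"
      using m integral_nonneg_eq_0_iff_AE[OF gp] integral_nonneg_eq_0_iff_AE[OF gm] nn
      by (auto simp: m_def)
    then have "AE x in M. g x = 0" by eventually_elim (simp add: split)
    then show ?thesis by (intro integral_eq_zero_AE) auto
  next
    case False
    then have m0: "m > 0" using m_nn by simp
    define \<nu> where "\<nu> h = distr (density M (\<lambda>x. ennreal (h x / m))) borel V" for h :: "'a \<Rightarrow> real"
    have dist: "real_distribution (\<nu> h) \<and> char (\<nu> h) u = (\<integral>x. of_real (h x) * cis (u * V x) \<partial>M) / m
        \<and> measure (\<nu> h) B = (\<integral>x. h x * indicator B (V x) \<partial>M) / m"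
      if h: "integrable M h" "\<And>x. h x \<ge> 0" "(\<integral>x. h x \<partial>M) = m" for h u
    proof -
      note [measurable] = borel_measurable_integrable[OF h(1)]
      have "prob_space (density M (\<lambda>x. ennreal (h x / m)))"
      proof
        have "emeasure (density M (\<lambda>x. ennreal (h x / m))) (space M) = (\<integral>\<^sup>+x. ennreal (h x / m) \<partial>M)"
          by (auto simp: emeasure_density cong: nn_integral_cong)
        also have "\<dots> = ennreal (\<integral>x. h x / m \<partial>M)"
          by (rule nn_integral_eq_integral) (use h m0 in auto)
        also have "\<dots> = 1" using h m0 by simp
        finally show "emeasure (density M (\<lambda>x. ennreal (h x / m)))
          (space (density M (\<lambda>x. ennreal (h x / m)))) = 1" by simp
      qed
      then interpret D: prob_space "density M (\<lambda>x. ennreal (h x / m))" .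
      have 1: "real_distribution (\<nu> h)"
        unfolding \<nu>_def by (rule D.real_distribution_distr) simp
      have "char (\<nu> h) u = (\<integral>x. iexp (u * V x) \<partial>density M (\<lambda>x. ennreal (h x / m)))"
        unfolding char_def \<nu>_def by (subst integral_distr) auto
      also have "\<dots> = (\<integral>x. (h x / m) *\<^sub>R iexp (u * V x) \<partial>M)"
        by (rule integral_density) (use h m0 in auto)
      also have "\<dots> = (\<integral>x. (of_real (h x) * cis (u * V x)) / of_real m \<partial>M)"
        by (intro Bochner_Integration.integral_cong) (auto simp: cis_conv_exp scaleR_conv_of_real)
      also have "\<dots> = (\<integral>x. of_real (h x) * cis (u * V x) \<partial>M) / m"
        by simp
      finally have 2: "char (\<nu> h) u = (\<integral>x. of_real (h x) * cis (u * V x) \<partial>M) / m" .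
      interpret N: real_distribution "\<nu> h" by fact
      have "measure (\<nu> h) B = (\<integral>x. indicator B x \<partial>\<nu> h)" by (simp add: \<nu>_def)
      also have "\<dots> = (\<integral>x. indicator B (V x) \<partial>density M (\<lambda>x. ennreal (h x / m)))"
        unfolding \<nu>_def by (subst integral_distr) auto
      also have "\<dots> = (\<integral>x. (h x / m) *\<^sub>R indicator B (V x) \<partial>M)"
        by (rule integral_density) (use h m0 in auto)
      also have "\<dots> = (\<integral>x. h x * indicator B (V x) \<partial>M) / m" by simp
      finally show ?thesis using 1 2 by blast
    qed
    have "\<nu> gp = \<nu> gm"
    proof (rule Levy_uniqueness)
      show "real_distribution (\<nu> gp)" "real_distribution (\<nu> gm)"
        using dist gp gm nn m m_def by auto
      show "char (\<nu> gp) = char (\<nu> gm)"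
        using dist gp gm nn m m_def eq by (auto simp: fun_eq_iff)
    qed
    then have "(\<integral>x. gp x * indicator B (V x) \<partial>M) = (\<integral>x. gm x * indicator B (V x) \<partial>M)"
      using dist[OF gp] dist[OF gm] nn m m_def m0 by auto
    moreover have "(\<integral>x. g x * indicator B (V x) \<partial>M) =
        (\<integral>x. gp x * indicator B (V x) \<partial>M) - (\<integral>x. gm x * indicator B (V x) \<partial>M)"
      unfolding split left_diff_distrib
      by (rule Bochner_Integration.integral_diff)
        (rule Bochner_Integration.integrable_bound[OF gp] Bochner_Integration.integrable_bound[OF gm];
          auto simp: indicator_def)+
    ultimately show ?thesis by simp
  qed
qed

text \<open>The hypothesis covers \<open>u\<close> and \<open>-u\<close>, so it passes to the
  conjugate of \<open>g\<close>, and from there to the real and imaginary parts. Complex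
  \<open>g\<close> are needed because in the induction below \<open>g\<close> already contains
  trigonometric factors.\<close>

lemma fourier_zero_complex:
  fixes g :: "'a \<Rightarrow> complex" and V :: "'a \<Rightarrow> real"
  assumes g: "integrable M g" and V[measurable]: "V \<in> borel_measurable M"
    and zero: "\<And>u. (\<integral>x. g x * cis (u * V x) \<partial>M) = 0"
    and B[measurable]: "B \<in> sets borel"
  shows "(\<integral>x. g x * indicator B (V x) \<partial>M) = 0"
proof -
  note [measurable] = borel_measurable_integrable[OF g]
  have [measurable]: "(\<lambda>x. cnj (g x)) \<in> borel_measurable M"
    using g by (intro borel_measurable_integrable) simp
  have cism[measurable]: "(\<lambda>x. cis (u * V x)) \<in> borel_measurable M" for u
    unfolding cis_conv_exp by measurable
  have int: "integrable M (\<lambda>x. g x * cis (u * V x))" for u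
    by (rule Bochner_Integration.integrable_bound[OF g]) (auto simp: norm_mult)
  have int': "integrable M (\<lambda>x. cnj (g x) * cis (u * V x))" for u
    by (rule Bochner_Integration.integrable_bound[OF g]) (auto simp: norm_mult)
  have zero': "(\<integral>x. cnj (g x) * cis (u * V x) \<partial>M) = 0" for u
  proof -
    have "(\<integral>x. cnj (g x) * cis (u * V x) \<partial>M) = (\<integral>x. cnj (g x * cis ((-u) * V x)) \<partial>M)"
      by (intro Bochner_Integration.integral_cong) (auto simp: cis_cnj)
    also have "\<dots> = cnj (\<integral>x. g x * cis ((-u) * V x) \<partial>M)"
      by (rule Bochner_Integration.integral_cnj)
    finally show ?thesis using zero[of "-u"] by simp
  qed
  have "(\<integral>x. of_real (Re (g x)) * cis (u * V x) \<partial>M) = 0" for u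
  proof -
    have "(\<integral>x. of_real (Re (g x)) * cis (u * V x) \<partial>M) =
      (\<integral>x. (g x * cis (u * V x) + cnj (g x) * cis (u * V x)) / 2 \<partial>M)"
      by (intro Bochner_Integration.integral_cong refl)
        (simp add: complex_add_cnj flip: distrib_right)
    also have "\<dots> = 0"
      using int int' zero zero' by simp
    finally show ?thesis .
  qed
  then have re: "(\<integral>x. Re (g x) * indicator B (V x) \<partial>M) = 0"
    by (intro fourier_zero_real) (use g in auto)
  have "(\<integral>x. of_real (Im (g x)) * cis (u * V x) \<partial>M) = 0" for u
  proof -
    have "(\<integral>x. of_real (Im (g x)) * cis (u * V x) \<partial>M) =
      (\<integral>x. (\<i> * (cnj (g x) * cis (u * V x)) - \<i> * (g x * cis (u * V x))) / 2 \<partial>M)"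
      by (intro Bochner_Integration.integral_cong refl) (simp add: complex_eq_iff algebra_simps)
    also have "\<dots> = 0"
      using int int' zero zero' by simp
    finally show ?thesis .
  qed
  then have im: "(\<integral>x. Im (g x) * indicator B (V x) \<partial>M) = 0"
    by (intro fourier_zero_real) (use g in auto)
  have int_B: "integrable M (\<lambda>x. g x * indicator B (V x))"
    by (rule Bochner_Integration.integrable_bound[OF g]) (auto simp: indicator_def)
  have re_im: "Re (z * indicator B v) = Re z * indicator B v" "Im (z * indicator B v) = Im z * indicator B v"
    for z and v :: real
    by (auto simp: indicator_def)
  have "Re (\<integral>x. g x * indicator B (V x) \<partial>M) = 0" "Im (\<integral>x. g x * indicator B (V x) \<partial>M) = 0"
    using re im integral_Re[OF int_B] integral_Im[OF int_B] unfolding re_im by simp_all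
  then show ?thesis by (simp add: complex_eq_iff)
qed

context wiener_space
begin

lemma cis_W_measurable:
  assumes "finite I" "I \<subseteq> {0..T}"
  shows "(\<lambda>\<omega>. cis (\<Sum>t\<in>I. k t * W t \<omega>)) \<in> borel_measurable M"
proof -
  have [measurable]: "(\<lambda>\<omega>. \<Sum>t\<in>I. k t * W t \<omega>) \<in> borel_measurable M"
    using assms W_measurable by (intro borel_measurable_sum borel_measurable_times) auto
  show ?thesis unfolding cis_conv_exp by measurable
qed

text \<open>
  Indicators replace trigonometric factors one time at a time, so that only the one-dimensional
  uniqueness theorem for characteristic functions is needed.
\<close>

lemma trig_orthogonal_imp_zero_on_cylinder:
  fixes Y :: "'a \<Rightarrow> real"
  assumes Y: "integrable M Y"
    and zero: "\<And>I k. finite I \<Longrightarrow> I \<subseteq> {0..T} \<Longrightarrow>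
      (\<integral>\<omega>. of_real (Y \<omega>) * cis (\<Sum>t\<in>I. k t * W t \<omega>) \<partial>M) = 0"
    and J: "finite J" "J \<subseteq> {0..T}" and B: "\<And>t. B t \<in> sets borel"
    and I: "finite I" "I \<subseteq> {0..T}" "I \<inter> J = {}"
  shows "(\<integral>\<omega>. of_real (Y \<omega>) * (\<Prod>t\<in>J. indicator (B t) (W t \<omega>)) * cis (\<Sum>t\<in>I. k t * W t \<omega>) \<partial>M) = 0"
  using J I
proof (induction J arbitrary: I k rule: finite_induct)
  case empty
  then show ?case using zero by simp
next
  case (insert s J)
  define g where "g \<omega> = of_real (Y \<omega>) * (\<Prod>t\<in>J. indicator (B t) (W t \<omega>)) *
    cis (\<Sum>t\<in>I. k t * W t \<omega>)" for \<omega>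
  note [measurable] = borel_measurable_integrable[OF Y] cis_W_measurable[OF insert.prems(2,3)]
  note [measurable] = B
  have WJ: "W t \<in> borel_measurable M" if "t \<in> J" for t
    using insert.prems that by (intro W_measurable) auto
  have [measurable]: "(\<lambda>\<omega>. \<Prod>t\<in>J. indicator (B t) (W t \<omega>) :: complex) \<in> borel_measurable M"
    using WJ by (intro borel_measurable_prod measurable_compose[OF _ borel_measurable_indicator]) auto
  have bd: "norm (\<Prod>t\<in>J. indicator (B t) (W t \<omega>) :: complex) \<le> 1" for \<omega>
    unfolding prod_norm [symmetric]
    by (intro prod_le_1) (auto simp: indicator_def)
  have "integrable M g"
    unfolding g_def
    by (rule Bochner_Integration.integrable_bound[OF Y])
      (use bd in \<open>auto simp: norm_mult intro!: mult_left_le\<close>)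
  moreover have "(\<integral>\<omega>. g \<omega> * cis (u * W s \<omega>) \<partial>M) = 0" for u
  proof -
    \<comment> \<open>The time \<open>s\<close> is new to \<open>I\<close>, so the factor
      \<open>cis (u * W s \<omega>)\<close> is absorbed into the trigonometric part by giving
      \<open>s\<close> the frequency \<open>u\<close>.\<close>
    have "s \<notin> I" using insert.prems by auto
    have "(\<integral>\<omega>. of_real (Y \<omega>) * (\<Prod>t\<in>J. indicator (B t) (W t \<omega>)) *
      cis (\<Sum>t\<in>insert s I. (k(s := u)) t * W t \<omega>) \<partial>M) = 0"
      using insert.prems insert.hyps by (intro insert.IH) auto
    moreover have "(\<Sum>t\<in>insert s I. (k(s := u)) t * W t \<omega>) = u * W s \<omega> + (\<Sum>t\<in>I. k t * W t \<omega>)" for \<omega>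
      using \<open>s \<notin> I\<close> insert.prems by (subst sum.insert) (auto intro!: sum.cong)
    ultimately show ?thesis by (simp add: g_def cis_mult[symmetric] mult_ac)
  qed
  moreover have "W s \<in> borel_measurable M"
    using insert.prems by (intro W_measurable) auto
  ultimately have "(\<integral>\<omega>. g \<omega> * indicator (B s) (W s \<omega>) \<partial>M) = 0"
    by (intro fourier_zero_complex) auto
  then show ?case
    using insert.hyps by (simp add: g_def mult_ac)
qed

text \<open>Cylinder sets are stable under intersection and the integral of \<open>Y\<close> over
  each of them is zero, so it is zero over every event generated by \<open>W\<close>.
  \<open>W_generates\<close> extends this to all events up to null sets, in particular to those
  where \<open>Y\<close> is positive or negative.\<close>

lemma trig_orthogonal_imp_AE_zero:
  fixes Y :: "'a \<Rightarrow> real"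
  assumes Y: "integrable M Y"
    and zero: "\<And>I k. finite I \<Longrightarrow> I \<subseteq> {0..T} \<Longrightarrow>
      (\<integral>\<omega>. of_real (Y \<omega>) * cis (\<Sum>t\<in>I. k t * W t \<omega>) \<partial>M) = 0"
  shows "AE \<omega> in M. Y \<omega> = 0"
proof -
  note [measurable] = borel_measurable_integrable[OF Y]
  define cyl where "cyl J B = {\<omega>\<in>space M. \<forall>t\<in>J. W t \<omega> \<in> B t}" for J and B :: "real \<Rightarrow> real set"
  define E where "E = {cyl J B | J B. finite J \<and> J \<subseteq> {0..T} \<and> (\<forall>t. B t \<in> sets borel)}"
  define G where "G = {W t -` S \<inter> space M | t S. t \<in> {0..T} \<and> S \<in> sets borel}"
  have cyl_zero: "(LINT \<omega>:cyl J B|M. Y \<omega>) = 0"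
    if "finite J" "J \<subseteq> {0..T}" "\<forall>t. B t \<in> sets borel" for J B
  proof -
    have "(\<integral>\<omega>. of_real (Y \<omega>) * (\<Prod>t\<in>J. indicator (B t) (W t \<omega>)) * cis (\<Sum>t\<in>{}. 0 * W t \<omega>) \<partial>M) = 0"
      using that by (intro trig_orthogonal_imp_zero_on_cylinder[OF Y zero]) auto
    moreover have "(\<integral>\<omega>. of_real (Y \<omega>) * (\<Prod>t\<in>J. indicator (B t) (W t \<omega>)) * cis (\<Sum>t\<in>{}. 0 * W t \<omega>) \<partial>M)
      = (\<integral>\<omega>. complex_of_real (indicator (cyl J B) \<omega> *\<^sub>R Y \<omega>) \<partial>M)"
    proof (intro Bochner_Integration.integral_cong refl)
      fix \<omega> assume "\<omega> \<in> space M"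
      then have "(\<Prod>t\<in>J. indicator (B t) (W t \<omega>)) = (indicator (cyl J B) \<omega> :: complex)"
        using that(1) by (auto simp: cyl_def indicator_def prod_zero_iff)
      then show "of_real (Y \<omega>) * (\<Prod>t\<in>J. indicator (B t) (W t \<omega>)) * cis (\<Sum>t\<in>{}. 0 * W t \<omega>)
        = complex_of_real (indicator (cyl J B) \<omega> *\<^sub>R Y \<omega>)"
        by (simp add: indicator_def)
    qed
    ultimately show ?thesis
      unfolding set_lebesgue_integral_def
      using integral_complex_of_real[of M "\<lambda>\<omega>. indicator (cyl J B) \<omega> *\<^sub>R Y \<omega>"] by simp
  qed
  have cyl_sets: "cyl J B \<in> sigma_sets (space M) G"
    if "finite J" "J \<subseteq> {0..T}" "\<forall>t. B t \<in> sets borel" for J B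
  proof (cases "J = {}")
    case True
    then show ?thesis by (simp add: cyl_def sigma_sets_top)
  next
    case False
    have Gp: "G \<subseteq> Pow (space M)" by (auto simp: G_def)
    have "cyl J B = (\<Inter>t\<in>J. W t -` B t \<inter> space M)"
      using False by (auto simp: cyl_def)
    moreover have "(\<Inter>t\<in>J. W t -` B t \<inter> space M) \<in> sigma_sets (space M) G"
    proof -
      interpret sg: sigma_algebra "space M" "sigma_sets (space M) G"
        by (rule sigma_algebra_sigma_sets[OF Gp])
      show ?thesis
      proof (rule sg.finite_INT)
        fix t assume "t \<in> J"
        then have "W t -` B t \<inter> space M \<in> G" using that unfolding G_def by blast
        then show "W t -` B t \<inter> space M \<in> sigma_sets (space M) G" by (rule sigma_sets.Basic)
      qed (use that False in auto)
    qed
    ultimately show ?thesis by simp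
  qed
  have G_sub: "G \<subseteq> E"
  proof
    fix A assume "A \<in> G"
    then obtain t S where A: "A = W t -` S \<inter> space M" "t \<in> {0..T}" "S \<in> sets borel"
      by (auto simp: G_def)
    then have "A = cyl {t} (\<lambda>_. S)" by (auto simp: cyl_def)
    then show "A \<in> E" using A unfolding E_def by blast
  qed
  have sig: "sigma_sets (space M) E = sigma_sets (space M) G"
  proof (intro sigma_sets_eqI)
    show "\<And>a. a \<in> E \<Longrightarrow> a \<in> sigma_sets (space M) G" using cyl_sets by (auto simp: E_def)
    show "\<And>b. b \<in> G \<Longrightarrow> b \<in> sigma_sets (space M) E" using G_sub by blast
  qed
  have "G \<subseteq> sets M"
    using W_measurable by (auto simp: G_def intro: measurable_sets)
  then have sub: "sigma_sets (space M) E \<subseteq> sets M"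
    unfolding sig by (rule sets.sigma_sets_subset)
  have "Int_stable E"
  proof (rule Int_stableI)
    fix a b assume "a \<in> E" "b \<in> E"
    then obtain J B J' B' where a: "a = cyl J B" "finite J" "J \<subseteq> {0..T}" "\<forall>t. B t \<in> sets borel"
      and b: "b = cyl J' B'" "finite J'" "J' \<subseteq> {0..T}" "\<forall>t. B' t \<in> sets borel"
      by (auto simp: E_def)
    \<comment> \<open>A time constrained by only one of the two cylinders receives
      \<open>UNIV\<close> from the other.\<close>
    have "a \<inter> b = cyl (J \<union> J') (\<lambda>t. (if t \<in> J then B t else UNIV) \<inter> (if t \<in> J' then B' t else UNIV))"
      by (auto simp: a b cyl_def split: if_splits)
    moreover have "\<forall>t. (if t \<in> J then B t else UNIV) \<inter> (if t \<in> J' then B' t else UNIV) \<in> sets borel"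
      using a b by auto
    ultimately show "a \<inter> b \<in> E"
      unfolding E_def using a b by blast
  qed
  have Yset: "set_integrable M A Y" if "A \<in> sets M" for A
    unfolding set_integrable_def using Y that by (intro integrable_mult_indicator)
  have Y0: "(\<integral>\<omega>. Y \<omega> \<partial>M) = 0"
    using cyl_zero[of "{}" "\<lambda>_. UNIV"] by (simp add: cyl_def set_integral_space[OF Y])
  have Ep: "E \<subseteq> Pow (space M)" by (auto simp: E_def cyl_def)
  have gen: "(LINT \<omega>:A|M. Y \<omega>) = 0" if "A \<in> sigma_sets (space M) E" for A
    using \<open>Int_stable E\<close> Ep that
  proof (induction rule: sigma_sets_induct_disjoint)
    case (basic A)
    then show ?case using cyl_zero by (auto simp: E_def)
  next
    case empty
    then show ?case by (simp add: set_lebesgue_integral_def)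
  next
    case (compl A)
    then have A: "A \<in> sets M" using sub by blast
    have "(LINT \<omega>:space M - A|M. Y \<omega>) = (\<integral>\<omega>. Y \<omega> \<partial>M) - (LINT \<omega>:A|M. Y \<omega>)"
    proof -
      have "(LINT \<omega>:space M|M. Y \<omega>) = (LINT \<omega>:(space M - A) \<union> A|M. Y \<omega>)"
        using sets.sets_into_space[OF A] by (simp add: Un_absorb2)
      also have "\<dots> = (LINT \<omega>:space M - A|M. Y \<omega>) + (LINT \<omega>:A|M. Y \<omega>)"
        using A by (intro set_integral_Un Yset) auto
      finally show ?thesis by (simp add: set_integral_space[OF Y])
    qed
    then show ?case using Y0 compl by simp
  next
    case (union A)
    then have A: "A i \<in> sets M" for i using sub by blast
    have "(LINT \<omega>:(\<Union>i. A i)|M. Y \<omega>) = (\<Sum>i. (LINT \<omega>:A i|M. Y \<omega>))"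
      using union(1) by (intro lebesgue_integral_countable_add[OF A] Yset) (auto simp: disjoint_family_on_def intro: A)
    then show ?case using union by simp
  qed
  have all: "(LINT \<omega>:A|M. Y \<omega>) = 0" if A: "A \<in> sets M" for A
  proof -
    obtain B where B: "B \<in> sigma_sets (space M) E" "AE \<omega> in M. \<omega> \<in> A \<longleftrightarrow> \<omega> \<in> B"
      using W_generates[OF A] unfolding sig G_def by blast
    have "(LINT \<omega>:A|M. Y \<omega>) = (LINT \<omega>:B|M. Y \<omega>)"
      unfolding set_lebesgue_integral_def
    proof (rule integral_cong_AE)
      have [measurable]: "A \<in> sets M" "B \<in> sets M" using A B sub by auto
      show "(\<lambda>\<omega>. indicator A \<omega> *\<^sub>R Y \<omega>) \<in> borel_measurable M"
        "(\<lambda>\<omega>. indicator B \<omega> *\<^sub>R Y \<omega>) \<in> borel_measurable M" by measurable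
      show "AE \<omega> in M. indicator A \<omega> *\<^sub>R Y \<omega> = indicator B \<omega> *\<^sub>R Y \<omega>"
        using B(2) by eventually_elim (simp add: indicator_def)
    qed
    then show ?thesis using gen B by simp
  qed
  have pos: "AE \<omega> in M. h \<omega> \<le> 0" if "integrable M h" "\<And>A. A \<in> sets M \<Longrightarrow> (LINT \<omega>:A|M. h \<omega>) = 0" for h :: "'a \<Rightarrow> real"
  proof -
    note [measurable] = borel_measurable_integrable[OF that(1)]
    define A where "A = {\<omega>\<in>space M. h \<omega> > 0}"
    have [measurable]: "A \<in> sets M" unfolding A_def by measurable
    have "(\<integral>\<omega>. indicator A \<omega> *\<^sub>R h \<omega> \<partial>M) = 0"
      using that(2)[of A] by (simp add: set_lebesgue_integral_def)
    moreover have "integrable M (\<lambda>\<omega>. indicator A \<omega> *\<^sub>R h \<omega>)"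
      using that(1) by (intro integrable_mult_indicator) auto
    ultimately have "AE \<omega> in M. indicator A \<omega> *\<^sub>R h \<omega> = 0"
      by (subst (asm) integral_nonneg_eq_0_iff_AE) (auto simp: A_def indicator_def)
    with AE_space show ?thesis
      by eventually_elim (auto simp: A_def indicator_def split: if_splits)
  qed
  have "AE \<omega> in M. Y \<omega> \<le> 0" by (rule pos[OF Y all])
  moreover have "AE \<omega> in M. - Y \<omega> \<le> 0"
    using Y all by (intro pos) (auto simp: set_lebesgue_integral_def)
  ultimately show ?thesis by eventually_elim auto
qed

end

section \<open>Cylindrical test variables\<close>

text \<open>This is the real part of (p - iq) exp(iL), with polynomials in the last coordinate only:
  that slot will hold \<open>W T\<close>. The family is closed under all partial derivatives, which
  reduces \<open>smooth_poly_growth\<close> to a growth bound for its members.\<close>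

definition trig_poly :: "nat \<Rightarrow> (nat \<Rightarrow> real) \<Rightarrow> real poly \<Rightarrow> real poly \<Rightarrow> real list \<Rightarrow> real" where
  "trig_poly n k p q xs =
    poly p (xs ! n) * cos (\<Sum>i\<le>n. k i * xs ! i) + poly q (xs ! n) * sin (\<Sum>i\<le>n. k i * xs ! i)"

lemma trig_poly_has_derivative:
  assumes i: "i \<le> n" and xs: "length xs = Suc n"
  shows "((\<lambda>y. trig_poly n k p q (xs[i := y])) has_field_derivative
    trig_poly n k ((if i = n then pderiv p else 0) + smult (k i) q)
      ((if i = n then pderiv q else 0) - smult (k i) p) xs) (at (xs ! i))"
proof -
  define S where "S = (\<Sum>j\<in>{..n}-{i}. k j * xs ! j)"
  have sum1: "(\<Sum>j\<le>n. k j * xs[i := y] ! j) = k i * y + S" for y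
    using i xs by (subst sum.remove[of _ i]) (auto simp: S_def intro!: sum.cong)
  have sum2: "(\<Sum>j\<le>n. k j * xs ! j) = k i * xs ! i + S"
    using i by (subst sum.remove[of _ i]) (auto simp: S_def)
  have "xs[i := y] ! n = (if i = n then y else xs ! n)" for y
    using i xs by auto
  then show ?thesis
    unfolding trig_poly_def sum1 sum2
    by (cases "i = n")
      (auto intro!: derivative_eq_intros poly_DERIV simp: algebra_simps)
qed

lemma foldr_partial_trig_poly:
  assumes "set \<alpha> \<subseteq> {..<Suc n}"
  shows "\<exists>p' q'. \<forall>xs. length xs = Suc n \<longrightarrow>
    foldr partial \<alpha> (trig_poly n k p q) xs = trig_poly n k p' q' xs"
  using assms
proof (induction \<alpha>)
  case Nil
  show ?case by auto
next
  case (Cons i \<alpha>)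
  then obtain p' q' where IH: "\<And>xs. length xs = Suc n \<Longrightarrow>
    foldr partial \<alpha> (trig_poly n k p q) xs = trig_poly n k p' q' xs" by auto
  have i: "i \<le> n" using Cons.prems by auto
  have "partial i (foldr partial \<alpha> (trig_poly n k p q)) xs =
    trig_poly n k ((if i = n then pderiv p' else 0) + smult (k i) q')
      ((if i = n then pderiv q' else 0) - smult (k i) p') xs" if xs: "length xs = Suc n" for xs
  proof -
    \<comment> \<open>Updating preserves the length, so the induction hypothesis holds on the whole
      coordinate line through \<open>xs\<close>; this permits rewriting under
      \<open>deriv\<close>.\<close>
    have "(\<lambda>y. foldr partial \<alpha> (trig_poly n k p q) (xs[i := y])) = (\<lambda>y. trig_poly n k p' q' (xs[i := y]))"
      using IH xs by auto
    then show ?thesis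
      using DERIV_imp_deriv[OF trig_poly_has_derivative[OF i xs, of k p' q']]
      by (simp add: partial_def[of i])
  qed
  then show ?case by (auto intro!: exI)
qed

lemma abs_poly_le:
  fixes p :: "real poly"
  shows "\<bar>poly p x\<bar> \<le> (\<Sum>i\<le>degree p. \<bar>coeff p i\<bar>) * (1 + \<bar>x\<bar>) ^ degree p"
proof -
  have "\<bar>poly p x\<bar> \<le> (\<Sum>i\<le>degree p. \<bar>coeff p i * x ^ i\<bar>)"
    unfolding poly_altdef by (rule sum_abs)
  also have "\<dots> \<le> (\<Sum>i\<le>degree p. \<bar>coeff p i\<bar> * (1 + \<bar>x\<bar>) ^ degree p)"
  proof (rule sum_mono)
    fix i assume i: "i \<in> {..degree p}"
    have "\<bar>x\<bar> ^ i \<le> (1 + \<bar>x\<bar>) ^ i" by (rule power_mono) auto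
    also have "\<dots> \<le> (1 + \<bar>x\<bar>) ^ degree p" using i by (intro power_increasing) auto
    finally show "\<bar>coeff p i * x ^ i\<bar> \<le> \<bar>coeff p i\<bar> * (1 + \<bar>x\<bar>) ^ degree p"
      by (auto simp: abs_mult power_abs intro: mult_left_mono)
  qed
  finally show ?thesis by (simp add: sum_distrib_right)
qed

lemma smooth_poly_growth_trig_poly: "smooth_poly_growth (Suc n) (trig_poly n k p q)"
  unfolding smooth_poly_growth_def
proof (intro allI impI conjI)
  fix \<alpha> :: "nat list" and xs :: "real list" and i
  assume \<alpha>: "set \<alpha> \<subseteq> {..<Suc n}" and xs: "length xs = Suc n" and i: "i < Suc n"
  obtain p' q' where eq: "\<And>xs. length xs = Suc n \<Longrightarrow>
    foldr partial \<alpha> (trig_poly n k p q) xs = trig_poly n k p' q' xs"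
    using foldr_partial_trig_poly[OF \<alpha>] by blast
  have "i \<le> n" using i by simp
  from trig_poly_has_derivative[OF this xs, of k p' q']
  show "(\<lambda>y. foldr partial \<alpha> (trig_poly n k p q) (xs[i := y])) field_differentiable at (xs ! i)"
    unfolding field_differentiable_def using eq xs by auto
next
  fix \<alpha> :: "nat list"
  assume \<alpha>: "set \<alpha> \<subseteq> {..<Suc n}"
  obtain p' q' where eq: "\<And>xs. length xs = Suc n \<Longrightarrow>
    foldr partial \<alpha> (trig_poly n k p q) xs = trig_poly n k p' q' xs"
    using foldr_partial_trig_poly[OF \<alpha>] by blast
  define C where "C p = (\<Sum>i\<le>degree p. \<bar>coeff p i\<bar>)" for p :: "real poly"
  define d where "d = max (degree p') (degree q')"
  have C: "C p \<ge> 0" for p by (auto simp: C_def intro: sum_nonneg)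
  show "\<exists>C k'. \<forall>xs. length xs = Suc n \<longrightarrow>
    \<bar>foldr partial \<alpha> (trig_poly n k p q) xs\<bar> \<le> C * (1 + (\<Sum>i<Suc n. \<bar>xs ! i\<bar>)) ^ k'"
  proof (intro exI allI impI)
    fix xs :: "real list" assume xs: "length xs = Suc n"
    let ?s = "\<Sum>i<Suc n. \<bar>xs ! i\<bar>"
    let ?L = "\<Sum>i\<le>n. k i * xs ! i"
    have le: "\<bar>xs ! n\<bar> \<le> ?s" by (rule member_le_sum) auto
    have pol: "\<bar>poly p (xs ! n)\<bar> \<le> C p * (1 + ?s) ^ d" if "degree p \<le> d" for p
    proof -
      have "\<bar>poly p (xs ! n)\<bar> \<le> C p * (1 + \<bar>xs ! n\<bar>) ^ degree p"
        unfolding C_def by (rule abs_poly_le)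
      also have "\<dots> \<le> C p * (1 + ?s) ^ degree p"
        using le C by (intro mult_left_mono power_mono) auto
      also have "\<dots> \<le> C p * (1 + ?s) ^ d"
        using C that by (intro mult_left_mono power_increasing) (auto intro: sum_nonneg add_nonneg_nonneg)
      finally show ?thesis .
    qed
    have "\<bar>trig_poly n k p' q' xs\<bar> \<le> \<bar>poly p' (xs ! n)\<bar> * \<bar>cos ?L\<bar> + \<bar>poly q' (xs ! n)\<bar> * \<bar>sin ?L\<bar>"
      unfolding trig_poly_def abs_mult[symmetric] by (rule abs_triangle_ineq)
    also have "\<dots> \<le> \<bar>poly p' (xs ! n)\<bar> + \<bar>poly q' (xs ! n)\<bar>"
      by (intro add_mono mult_left_le) auto
    also have "\<dots> \<le> C p' * (1 + ?s) ^ d + C q' * (1 + ?s) ^ d"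
      by (intro add_mono pol) (auto simp: d_def)
    finally show "\<bar>foldr partial \<alpha> (trig_poly n k p q) xs\<bar> \<le> (C p' + C q') * (1 + ?s) ^ d"
      using eq xs by (simp add: distrib_right)
  qed
qed

section \<open>Exponential and polynomial moments of \<open>W T\<close>\<close>

lemma power_le_fact_exp: "x ^ n \<le> fact n * exp x" if "x \<ge> 0" for x :: real
proof -
  have "x ^ n / fact n \<le> (\<Sum>k. x ^ k / fact k)"
    using summable_exp[of x] that
      sum_le_suminf[OF summable_exp_generic[of x], of "{n}"]
    by (simp add: divide_simps)
  also have "\<dots> = exp x" by (simp add: exp_def divide_inverse scaleR_conv_of_real mult.commute)
  finally show ?thesis by (simp add: field_simps)
qed

text \<open>Completing the square turns the integrand into a constant multiple of the normal density
  with mean \<open>\<mu> + c * \<sigma>\<^sup>2\<close>.\<close>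

lemma integrable_normal_exp:
  assumes "\<sigma> > 0"
  shows "integrable lborel (\<lambda>x. normal_density \<mu> \<sigma> x * exp (c * x))"
proof -
  have "normal_density \<mu> \<sigma> x * exp (c * x) =
      exp (c * \<mu> + c\<^sup>2 * \<sigma>\<^sup>2 / 2) * normal_density (\<mu> + c * \<sigma>\<^sup>2) \<sigma> x" for x
  proof -
    have "- (x - \<mu>)\<^sup>2 / (2 * \<sigma>\<^sup>2) + c * x =
        (c * \<mu> + c\<^sup>2 * \<sigma>\<^sup>2 / 2) + (- (x - (\<mu> + c * \<sigma>\<^sup>2))\<^sup>2 / (2 * \<sigma>\<^sup>2))"
      using assms by (simp add: field_simps power2_eq_square)
    then show ?thesis
      by (simp add: normal_density_def exp_add[symmetric])
  qed
  then show ?thesis using integrable_normal_density[OF assms] by simp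
qed

context wiener_space
begin

lemma W_T_AE_eq: "AE \<omega> in M. W T \<omega> = W T \<omega> - W 0 \<omega>"
  using W_start by eventually_elim simp

lemma W_0_measurable [measurable]: "W 0 \<in> borel_measurable M"
  using T_pos by (intro W_measurable) simp

lemma W_T_measurable [measurable]: "W T \<in> borel_measurable M"
  using T_pos by (intro W_measurable) simp

lemma integrable_exp_W_T: "integrable M (\<lambda>\<omega>. exp (c * W T \<omega>))"
proof -
  have "integrable M (\<lambda>\<omega>. exp (c * (W T \<omega> - W 0 \<omega>)))"
    using integrable_normal_exp[of "sqrt T" 0 c] T_pos
      distributed_integrable[OF W_normal[of 0 T], of "\<lambda>x. exp (c * x)"]
    by auto
  moreover have "AE \<omega> in M. exp (c * (W T \<omega> - W 0 \<omega>)) = exp (c * W T \<omega>)"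
    using W_T_AE_eq by eventually_elim simp
  ultimately show ?thesis
    by (subst integrable_cong_AE[symmetric]) auto
qed

lemma integrable_exp_abs_W_T: "integrable M (\<lambda>\<omega>. exp (c * \<bar>W T \<omega>\<bar>))"
proof (rule Bochner_Integration.integrable_bound[OF Bochner_Integration.integrable_add[OF
        integrable_exp_W_T[of c] integrable_exp_W_T[of "-c"]]])
  have "exp (c * \<bar>x\<bar>) \<le> exp (c * x) + exp (- c * x)" for x
    by (cases "x \<ge> 0") auto
  then show "AE \<omega> in M. norm (exp (c * \<bar>W T \<omega>\<bar>)) \<le> norm (exp (c * W T \<omega>) + exp (- c * W T \<omega>))"
    by (intro AE_I2) (simp add: abs_of_pos add_pos_pos)
qed auto

lemma integrable_power_W_T: "integrable M (\<lambda>\<omega>. W T \<omega> ^ n)"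
  by (rule Bochner_Integration.integrable_bound[OF integrable_mult_right[OF integrable_exp_abs_W_T[of 1], of "fact n"]])
    (use power_le_fact_exp[of "\<bar>W T _\<bar>" n] in \<open>auto simp: power_abs\<close>)

lemma integrable_poly_W_T: "integrable M (\<lambda>\<omega>. poly p (W T \<omega>))"
  unfolding poly_altdef by (intro Bochner_Integration.integrable_sum integrable_mult_right integrable_power_W_T)

end

section \<open>Square integrability over probability and over time and probability jointly\<close>

lemma square_integrable_imp_integrable_mult:
  assumes "square_integrable N f" "square_integrable N g"
  shows "integrable N (\<lambda>x. f x * g x)"
proof (rule Bochner_Integration.integrable_bound)
  show "integrable N (\<lambda>x. (f x)\<^sup>2 + (g x)\<^sup>2)"
    using assms by (auto simp: square_integrable_def)
  show "(\<lambda>x. f x * g x) \<in> borel_measurable N"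
    using assms by (auto simp: square_integrable_def)
  have "\<bar>a * b\<bar> \<le> a\<^sup>2 + b\<^sup>2" for a b :: real
    using sum_squares_bound[of "\<bar>a\<bar>" "\<bar>b\<bar>"] zero_le_power2[of a] zero_le_power2[of b]
      abs_ge_zero[of "a * b"]
    unfolding abs_mult power2_abs by linarith
  then show "AE x in N. norm (f x * g x) \<le> norm ((f x)\<^sup>2 + (g x)\<^sup>2)"
    by (intro AE_I2) simp
qed

lemma square_integrable_add:
  assumes "square_integrable N f" "square_integrable N g"
  shows "square_integrable N (\<lambda>x. f x + g x)"
proof -
  have "integrable N (\<lambda>x. (f x)\<^sup>2 + (g x)\<^sup>2 + 2 * (f x * g x))"
    using assms square_integrable_imp_integrable_mult[OF assms]
    by (auto simp: square_integrable_def)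
  moreover have "(\<lambda>x. f x + g x) \<in> borel_measurable N"
    using assms by (auto simp: square_integrable_def)
  ultimately show ?thesis
    by (simp add: square_integrable_def power2_sum mult.assoc)
qed

lemma square_integrable_bounded_mult:
  assumes f: "square_integrable N f" and g: "g \<in> borel_measurable N" "\<And>x. \<bar>g x\<bar> \<le> B"
  shows "square_integrable N (\<lambda>x. f x * g x)"
proof -
  have [measurable]: "f \<in> borel_measurable N" using f by (simp add: square_integrable_def)
  have "integrable N (\<lambda>x. (f x * g x)\<^sup>2)"
  proof (rule Bochner_Integration.integrable_bound)
    show "integrable N (\<lambda>x. B\<^sup>2 * (f x)\<^sup>2)"
      using f by (auto simp: square_integrable_def)
    show "AE x in N. norm ((f x * g x)\<^sup>2) \<le> norm (B\<^sup>2 * (f x)\<^sup>2)"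
    proof (rule AE_I2)
      fix x
      have "(g x)\<^sup>2 \<le> B\<^sup>2" using g(2)[of x] by (simp add: abs_le_square_iff[symmetric])
      then show "norm ((f x * g x)\<^sup>2) \<le> norm (B\<^sup>2 * (f x)\<^sup>2)"
        by (simp add: power_mult_distrib mult.commute[of "(f x)\<^sup>2"] mult_right_mono)
    qed
  qed (use g in measurable)
  then show ?thesis using g(1) by (simp add: square_integrable_def)
qed

context wiener_space
begin

lemma finite_measure_time: "finite_measure (restrict_space lborel {0..T})"
  using T_pos by (intro finite_measureI) (simp add: emeasure_restrict_space space_restrict_space)

lemma pair_sigma_finite_time: "pair_sigma_finite (restrict_space lborel {0..T}) M"
proof -
  interpret L: finite_measure "restrict_space lborel {0..T}"
    by (rule finite_measure_time)
  show ?thesis ..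
qed

lemma measurable_time_space_fst:
  assumes "f \<in> borel_measurable borel"
  shows "(\<lambda>(s, \<omega>). f s) \<in> borel_measurable (time_space M T)"
  using measurable_compose[OF measurable_fst measurable_restrict_space1[of f lborel borel]] assms
  by (simp add: time_space_def case_prod_unfold)

lemma measurable_time_space_snd:
  assumes "f \<in> borel_measurable M"
  shows "(\<lambda>(s, \<omega>). f \<omega>) \<in> borel_measurable (time_space M T)"
  using measurable_compose[OF measurable_snd assms]
  by (simp add: time_space_def case_prod_unfold)

end

lemma (in wiener_space) integrable_time_space_snd:
  fixes f :: "'a \<Rightarrow> 'b :: {banach, second_countable_topology}"
  assumes f: "integrable M f"
  shows "integrable (time_space M T) (\<lambda>(s, \<omega>). f \<omega>)"
proof -
  interpret L: finite_measure "restrict_space lborel {0..T}"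
    by (rule finite_measure_time)
  interpret P: pair_sigma_finite "restrict_space lborel {0..T}" M
    by (rule pair_sigma_finite_time)
  note [measurable] = borel_measurable_integrable[OF f]
  show ?thesis
    unfolding time_space_def
    by (rule P.Fubini_integrable) (use f in auto)
qed

text \<open>The time \<open>T\<close> occupies the last slot because the test variables contain
  powers of \<open>W T\<close> besides exp(iL). An increasing order of the times is imposed only
  later, where independence of increments enters.\<close>

locale trig_test = wiener_space +
  fixes n :: nat and \<tau> :: "nat \<Rightarrow> real" and k :: "nat \<Rightarrow> real"
  assumes tau_range: "\<And>i. i \<le> n \<Longrightarrow> \<tau> i \<in> {0..T}" and tau_last: "\<tau> n = T"
begin

definition L :: "'a \<Rightarrow> real" where
  "L \<omega> = (\<Sum>i\<le>n. k i * W (\<tau> i) \<omega>)"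

definition K :: "real \<Rightarrow> real" where
  "K s = (\<Sum>i\<le>n. k i * indicator {0..\<tau> i} s)"

lemma L_measurable [measurable]: "L \<in> borel_measurable M"
proof -
  have "(\<lambda>\<omega>. \<Sum>i\<le>n. k i * W (\<tau> i) \<omega>) \<in> borel_measurable M"
    using W_measurable tau_range by (intro borel_measurable_sum borel_measurable_times) auto
  then show ?thesis by (simp add: L_def[abs_def])
qed

lemma K_measurable [measurable]: "K \<in> borel_measurable borel"
  unfolding K_def[abs_def] by measurable

lemma K_bounded: "\<bar>K s\<bar> \<le> (\<Sum>i\<le>n. \<bar>k i\<bar>)"
  unfolding K_def
  by (rule order_trans[OF sum_abs]) (auto intro!: sum_mono simp: indicator_def)

lemma K_measurable_time [measurable]: "(\<lambda>(s, \<omega>). K s) \<in> borel_measurable (time_space M T)"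
  by (intro measurable_time_space_fst K_measurable)

lemma square_integrable_poly: "square_integrable M (\<lambda>\<omega>. poly p (W T \<omega>))"
  using integrable_poly_W_T[of "p * p"]
  by (auto simp: square_integrable_def power2_eq_square intro!: borel_measurable_continuous_onI
      measurable_compose[OF W_T_measurable] continuous_intros)

lemma square_integrable_poly_time: "square_integrable (time_space M T) (\<lambda>(s, \<omega>). poly p (W T \<omega>))"
proof -
  have "integrable (time_space M T) (\<lambda>(s, \<omega>). (poly p (W T \<omega>))\<^sup>2)"
    using square_integrable_poly[of p] by (intro integrable_time_space_snd) (simp add: square_integrable_def)
  moreover have "(\<lambda>(s, \<omega>). poly p (W T \<omega>)) \<in> borel_measurable (time_space M T)"
    using square_integrable_poly[of p] by (intro measurable_time_space_snd) (simp add: square_integrable_def)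
  ultimately show ?thesis
    by (simp add: square_integrable_def case_prod_unfold)
qed

definition test_fun :: "real poly \<Rightarrow> real poly \<Rightarrow> 'a \<Rightarrow> real" where
  "test_fun p q \<omega> = poly p (W T \<omega>) * cos (L \<omega>) + poly q (W T \<omega>) * sin (L \<omega>)"

text \<open>Chain rule: the indicator of \<open>{0..T}\<close> is the derivative of
  \<open>W T\<close>, \<open>K\<close> is that of \<open>L\<close>, and differentiating p cos L + q
  sin L in L gives q cos L - p sin L, which is \<open>test_fun q (- p)\<close>.\<close>

definition test_deriv :: "real poly \<Rightarrow> real poly \<Rightarrow> real \<Rightarrow> 'a \<Rightarrow> real" where
  "test_deriv p q s \<omega> = indicator {0..T} s * test_fun (pderiv p) (pderiv q) \<omega>
    + K s * test_fun q (- p) \<omega>"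

lemma square_integrable_test_fun: "square_integrable M (test_fun p q)"
  unfolding test_fun_def[abs_def]
  by (intro square_integrable_add square_integrable_bounded_mult[where B = 1] square_integrable_poly) auto

lemma square_integrable_test_fun_time:
  "square_integrable (time_space M T) (\<lambda>(s, \<omega>). test_fun p q \<omega>)"
proof -
  have "integrable (time_space M T) (\<lambda>(s, \<omega>). (test_fun p q \<omega>)\<^sup>2)"
    using square_integrable_test_fun[of p q] by (intro integrable_time_space_snd) (simp add: square_integrable_def)
  moreover have "(\<lambda>(s, \<omega>). test_fun p q \<omega>) \<in> borel_measurable (time_space M T)"
    using square_integrable_test_fun[of p q] by (intro measurable_time_space_snd) (simp add: square_integrable_def)
  ultimately show ?thesis
    by (simp add: square_integrable_def case_prod_unfold)
qed

lemma square_integrable_test_deriv: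
  "square_integrable (time_space M T) (\<lambda>(s, \<omega>). test_deriv p q s \<omega>)"
proof -
  have "square_integrable (time_space M T)
      (\<lambda>x. (case x of (s, \<omega>) \<Rightarrow> test_fun (pderiv p) (pderiv q) \<omega>) * (case x of (s, \<omega>) \<Rightarrow> indicator {0..T} s) +
        (case x of (s, \<omega>) \<Rightarrow> test_fun q (- p) \<omega>) * (case x of (s, \<omega>) \<Rightarrow> K s))"
  proof (intro square_integrable_add square_integrable_bounded_mult[where B = "1 + (\<Sum>i\<le>n. \<bar>k i\<bar>)"]
      square_integrable_test_fun_time)
    show "(\<lambda>(s, \<omega>). indicator {0..T} s) \<in> borel_measurable (time_space M T)"
      by (intro measurable_time_space_fst) auto
    fix x :: "real \<times> 'a"
    have "\<bar>K (fst x)\<bar> \<le> (\<Sum>i\<le>n. \<bar>k i\<bar>)" by (rule K_bounded)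
    then show "\<bar>case x of (s, \<omega>) \<Rightarrow> K s\<bar> \<le> 1 + (\<Sum>i\<le>n. \<bar>k i\<bar>)"
      "\<bar>case x of (s, \<omega>) \<Rightarrow> indicator {0..T} s\<bar> \<le> 1 + (\<Sum>i\<le>n. \<bar>k i\<bar>)"
      by (auto simp: case_prod_unfold indicator_def intro!: sum_nonneg add_nonneg_nonneg)
  qed (rule K_measurable_time)
  then show ?thesis
    by (simp add: test_deriv_def case_prod_unfold mult.commute)
qed

lemma smooth_malliavin_test: "smooth_malliavin T W (test_fun p q) (test_deriv p q)"
  unfolding smooth_malliavin_def
proof (intro exI conjI)
  let ?ts = "map \<tau> [0..<Suc n]"
  show "set ?ts \<subseteq> {0..T}" using tau_range by auto
  show "smooth_poly_growth (length ?ts) (trig_poly n k p q)"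
    using smooth_poly_growth_trig_poly[of n k p q] by simp
  let ?xs = "\<lambda>\<omega>. map (\<lambda>t. W t \<omega>) ?ts"
  have nth: "?xs \<omega> ! i = W (\<tau> i) \<omega>" if "i \<le> n" for i \<omega>
    using that by (simp del: upt_Suc)
  have len: "length (?xs \<omega>) = Suc n" for \<omega> by simp
  have tp: "trig_poly n k p q (?xs \<omega>) = test_fun p q \<omega>" for p q \<omega>
  proof -
    have "(\<Sum>i\<le>n. k i * ?xs \<omega> ! i) = L \<omega>"
      unfolding L_def by (intro sum.cong refl) (use nth in auto)
    then show ?thesis
      unfolding trig_poly_def test_fun_def using nth[of n \<omega>] tau_last by (simp only: order_refl)
  qed
  show "test_fun p q = (\<lambda>\<omega>. trig_poly n k p q (?xs \<omega>))" by (intro ext) (rule tp[symmetric])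
  have part: "partial i (trig_poly n k p q) (?xs \<omega>) =
    (if i = n then test_fun (pderiv p) (pderiv q) \<omega> else 0) + k i * test_fun q (- p) \<omega>"
    if "i \<le> n" for i \<omega>
  proof -
    have "partial i (trig_poly n k p q) (?xs \<omega>) =
      test_fun ((if i = n then pderiv p else 0) + smult (k i) q)
      ((if i = n then pderiv q else 0) - smult (k i) p) \<omega>"
      unfolding partial_def
      using DERIV_imp_deriv[OF trig_poly_has_derivative[OF that len, of k p q]] tp by simp
    also have "\<dots> = (if i = n then test_fun (pderiv p) (pderiv q) \<omega> else 0) + k i * test_fun q (- p) \<omega>"
      by (simp add: test_fun_def algebra_simps)
    finally show ?thesis .
  qed
  show "test_deriv p q = (\<lambda>s \<omega>. \<Sum>i<length ?ts. partial i (trig_poly n k p q) (?xs \<omega>) * indicator {0..?ts ! i} s)"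
  proof (intro ext)
    fix s \<omega>
    have "(\<Sum>i<length ?ts. partial i (trig_poly n k p q) (?xs \<omega>) * indicator {0..?ts ! i} s) =
      (\<Sum>i\<le>n. ((if i = n then test_fun (pderiv p) (pderiv q) \<omega> else 0) + k i * test_fun q (- p) \<omega>)
         * indicator {0..\<tau> i} s)"
    proof (rule sum.cong)
      show "{..<length ?ts} = {..n}" by auto
      fix i assume "i \<in> {..n}"
      then have i: "i \<le> n" by simp
      then have "?ts ! i = \<tau> i" by (simp del: upt_Suc)
      then show "partial i (trig_poly n k p q) (?xs \<omega>) * indicator {0..?ts ! i} s =
        ((if i = n then test_fun (pderiv p) (pderiv q) \<omega> else 0) + k i * test_fun q (- p) \<omega>)
         * indicator {0..\<tau> i} s"
        by (simp only: part[OF i])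
    qed
    also have "\<dots> = (\<Sum>i\<le>n. (if i = n then test_fun (pderiv p) (pderiv q) \<omega> * indicator {0..\<tau> i} s else 0))
       + (\<Sum>i\<le>n. k i * indicator {0..\<tau> i} s * test_fun q (- p) \<omega>)"
      unfolding sum.distrib[symmetric] by (rule sum.cong) (auto simp: algebra_simps)
    also have "\<dots> = test_deriv p q s \<omega>"
      unfolding test_deriv_def K_def sum_distrib_right by (simp add: tau_last)
    finally show "test_deriv p q s \<omega> =
      (\<Sum>i<length ?ts. partial i (trig_poly n k p q) (?xs \<omega>) * indicator {0..?ts ! i} s)" ..
  qed
qed

text \<open>The variable is itself smooth, so a constant sequence approximates it in the
  closure.\<close>

lemma malliavin_derivative_test: "malliavin_derivative M T W (test_fun p q) (test_deriv p q)"
  unfolding malliavin_derivative_def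
proof (intro conjI square_integrable_test_fun square_integrable_test_deriv exI allI)
  show "smooth_malliavin T W (test_fun p q) (test_deriv p q)" by (rule smooth_malliavin_test)
qed (simp_all add: case_prod_unfold)

definition E :: "nat \<Rightarrow> 'a \<Rightarrow> complex" where
  "E m \<omega> = of_real (W T \<omega> ^ m) * cis (L \<omega>)"

lemma E_measurable [measurable]: "E m \<in> borel_measurable M"
  unfolding E_def[abs_def] cis_conv_exp by measurable

lemma norm_E: "norm (E m \<omega>) = \<bar>W T \<omega>\<bar> ^ m"
  by (simp add: E_def norm_mult power_abs flip: of_real_power)

lemma E_eq_test_fun: "E m \<omega> = of_real (test_fun (monom 1 m) 0 \<omega>) + \<i> * of_real (test_fun 0 (monom 1 m) \<omega>)"
  by (simp add: E_def test_fun_def poly_monom complex_eq_iff)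

text \<open>The adjoint relation concerns real variables only. It is applied to W_T^m cos L and to
  W_T^m sin L, and the two identities are recombined into the complex derivative of W_T^m exp(iL).
  For \<open>m = 0\<close> the truncated index \<open>m - 1\<close> is harmless, since its term
  carries the factor \<open>of_nat m\<close>.\<close>

lemma skorokhod_duality:
  assumes "skorokhod_integral M T W u Z"
  shows "(\<integral>\<omega>. E m \<omega> * of_real (Z \<omega>) \<partial>M) =
    (\<integral>(s, \<omega>). (of_nat m * E (m - 1) \<omega> + \<i> * of_real (K s) * E m \<omega>) * of_real (u s \<omega>) \<partial>time_space M T)"
proof -
  let ?N = "time_space M T"
  have u: "square_integrable ?N (\<lambda>(s, \<omega>). u s \<omega>)" and Z: "square_integrable M Z"
    and dual: "\<And>p q. (\<integral>(s, \<omega>). test_deriv p q s \<omega> * u s \<omega> \<partial>?N) = (\<integral>\<omega>. test_fun p q \<omega> * Z \<omega> \<partial>M)"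
    using assms malliavin_derivative_test by (auto simp: skorokhod_integral_def)
  define p where "p = (monom 1 m :: real poly)"
  have iM: "integrable M (\<lambda>\<omega>. complex_of_real (test_fun p q \<omega> * Z \<omega>))" for p q
    by (intro integrable_of_real square_integrable_imp_integrable_mult square_integrable_test_fun Z)
  have iN: "integrable ?N (\<lambda>(s, \<omega>). complex_of_real (test_deriv p q s \<omega> * u s \<omega>))" for p q
    using integrable_of_real[OF square_integrable_imp_integrable_mult[OF square_integrable_test_deriv u]]
    by (simp add: case_prod_unfold)
  have "(\<integral>\<omega>. E m \<omega> * of_real (Z \<omega>) \<partial>M) =
    (\<integral>\<omega>. of_real (test_fun p 0 \<omega> * Z \<omega>) + \<i> * of_real (test_fun 0 p \<omega> * Z \<omega>) \<partial>M)"
    by (simp add: E_eq_test_fun p_def distrib_right mult.assoc)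
  also have "\<dots> = of_real (\<integral>\<omega>. test_fun p 0 \<omega> * Z \<omega> \<partial>M) + \<i> * of_real (\<integral>\<omega>. test_fun 0 p \<omega> * Z \<omega> \<partial>M)"
    by (simp only: Bochner_Integration.integral_add[OF iM integrable_mult_right[OF iM]]
        integral_mult_right_zero integral_complex_of_real)
  also have "\<dots> = of_real (\<integral>(s, \<omega>). test_deriv p 0 s \<omega> * u s \<omega> \<partial>?N) +
     \<i> * of_real (\<integral>(s, \<omega>). test_deriv 0 p s \<omega> * u s \<omega> \<partial>?N)"
    by (simp only: dual)
  also have "\<dots> = (\<integral>(s, \<omega>). of_real (test_deriv p 0 s \<omega> * u s \<omega>) \<partial>?N) +
     \<i> * (\<integral>(s, \<omega>). of_real (test_deriv 0 p s \<omega> * u s \<omega>) \<partial>?N)"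
    unfolding case_prod_unfold integral_complex_of_real ..
  also have "\<dots> = (\<integral>x. (case x of (s, \<omega>) \<Rightarrow> of_real (test_deriv p 0 s \<omega> * u s \<omega>)) +
     \<i> * (case x of (s, \<omega>) \<Rightarrow> of_real (test_deriv 0 p s \<omega> * u s \<omega>)) \<partial>?N)"
    by (simp only: Bochner_Integration.integral_add[OF iN integrable_mult_right[OF iN]]
        integral_mult_right_zero)
  also have "\<dots> = (\<integral>(s, \<omega>). (of_nat m * E (m - 1) \<omega> + \<i> * of_real (K s) * E m \<omega>) * of_real (u s \<omega>) \<partial>?N)"
  proof (rule Bochner_Integration.integral_cong[OF refl])
    \<comment> \<open>On this space the indicator of \<open>{0..T}\<close> in
      \<open>test_deriv\<close> equals one.\<close>
    fix x assume "x \<in> space ?N"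
    then obtain s \<omega> where x: "x = (s, \<omega>)" "s \<in> {0..T}"
      by (auto simp: time_space_def space_pair_measure space_restrict_space)
    show "(case x of (s, \<omega>) \<Rightarrow> of_real (test_deriv p 0 s \<omega> * u s \<omega>)) +
       \<i> * (case x of (s, \<omega>) \<Rightarrow> of_real (test_deriv 0 p s \<omega> * u s \<omega>)) =
       (case x of (s, \<omega>) \<Rightarrow> (of_nat m * E (m - 1) \<omega> + \<i> * of_real (K s) * E m \<omega>) * of_real (u s \<omega>))"
      using x by (simp add: E_def test_deriv_def test_fun_def p_def pderiv_monom poly_monom
          complex_eq_iff algebra_simps flip: of_real_power)
  qed
  finally show ?thesis .
qed

end

section \<open>The moment hierarchy\<close>

locale linear_sde_test = trig_test +
  fixes X :: "real \<Rightarrow> 'a \<Rightarrow> real" and x0 A c :: real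
  assumes solution: "skorokhod_sde_solution M T W x0 (\<lambda>\<omega>. A - c / T * W T \<omega>) c X"
    and c_nonzero: "c \<noteq> 0"
begin

abbreviation LT :: "real measure" where
  "LT \<equiv> restrict_space lborel {0..T}"

sublocale P: pair_sigma_finite LT M
  by (rule pair_sigma_finite_time)

definition coef :: "'a \<Rightarrow> real" where
  "coef \<omega> = A - c / T * W T \<omega>"

lemma X_measurable [measurable]: "(\<lambda>(s, \<omega>). X s \<omega>) \<in> borel_measurable (LT \<Otimes>\<^sub>M M)"
  using solution by (simp add: skorokhod_sde_solution_def time_space_def)

lemma X_section_measurable: "X s \<in> borel_measurable M" if "s \<in> {0..T}"
  using measurable_compose[OF measurable_Pair1' X_measurable, of s] that
  by (simp add: space_restrict_space)

text \<open>The domain of the Skorokhod integral at time \<open>T\<close> gives square integrability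
  of \<open>c\<close> times \<open>X\<close>, and \<open>c\<close> can be divided out.\<close>

lemma square_integrable_X: "square_integrable (time_space M T) (\<lambda>(s, \<omega>). X s \<omega>)"
proof -
  have "\<exists>Z. skorokhod_integral M T W (\<lambda>s \<omega>. indicator {0..T} s * (c * X s \<omega>)) Z"
    using solution T_pos unfolding skorokhod_sde_solution_def by (meson atLeastAtMost_iff less_imp_le order_refl)
  then obtain Z where "skorokhod_integral M T W (\<lambda>s \<omega>. indicator {0..T} s * (c * X s \<omega>)) Z" ..
  then have "integrable (time_space M T) (\<lambda>x. ((indicator {0..T} (fst x) * (c * X (fst x) (snd x))))\<^sup>2)"
    by (simp add: skorokhod_integral_def square_integrable_def case_prod_unfold)
  also have "?this \<longleftrightarrow> integrable (time_space M T) (\<lambda>x. c\<^sup>2 * (X (fst x) (snd x))\<^sup>2)"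
    by (rule Bochner_Integration.integrable_cong)
      (auto simp: time_space_def space_pair_measure space_restrict_space power_mult_distrib)
  finally have "integrable (time_space M T) (\<lambda>x. (X (fst x) (snd x))\<^sup>2)"
    using c_nonzero by simp
  then show ?thesis
    using X_measurable by (simp add: square_integrable_def time_space_def case_prod_unfold)
qed

lemma integrable_power_X: "integrable (LT \<Otimes>\<^sub>M M) (\<lambda>(s, \<omega>). W T \<omega> ^ j * X s \<omega>)"
  using square_integrable_imp_integrable_mult[OF square_integrable_poly_time[of "monom 1 j"] square_integrable_X]
  by (simp add: time_space_def case_prod_unfold poly_monom)

lemma E_measurable_time [measurable]: "(\<lambda>(s, \<omega>). E j \<omega>) \<in> borel_measurable (LT \<Otimes>\<^sub>M M)"
  using measurable_time_space_snd[OF E_measurable] by (simp add: time_space_def)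

lemma integrable_E_X: "integrable (LT \<Otimes>\<^sub>M M) (\<lambda>(s, \<omega>). E j \<omega> * of_real (X s \<omega>))"
proof (rule Bochner_Integration.integrable_bound[OF integrable_power_X[of j]])
  show "(\<lambda>(s, \<omega>). E j \<omega> * of_real (X s \<omega>)) \<in> borel_measurable (LT \<Otimes>\<^sub>M M)"
    using E_measurable_time[of j] X_measurable unfolding case_prod_unfold by measurable
qed (simp add: norm_E norm_mult abs_mult power_abs case_prod_unfold)

lemma coef_E: "of_real (coef \<omega>) * E j \<omega> = of_real A * E j \<omega> - of_real (c / T) * E (Suc j) \<omega>"
  by (simp add: coef_def E_def algebra_simps)

definition m :: "nat \<Rightarrow> real \<Rightarrow> complex" where
  "m j s = (\<integral>\<omega>. E j \<omega> * of_real (X s \<omega>) \<partial>M)"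

lemma integrable_m: "integrable LT (m j)"
  using P.integrable_fst'[OF integrable_E_X[of j]] by (simp add: m_def[abs_def])

text \<open>The bound is integrated over time because that is the sense in which \<open>X\<close> is
  controlled. It suffices for the truncation error, which is estimated through its time
  integral.\<close>

lemma norm_m_le: "(\<integral>s. norm (m j s) \<partial>LT) \<le> (\<integral>(s, \<omega>). \<bar>W T \<omega>\<bar> ^ j * \<bar>X s \<omega>\<bar> \<partial>(LT \<Otimes>\<^sub>M M))"
proof -
  let ?f = "\<lambda>(s, \<omega>). \<bar>W T \<omega>\<bar> ^ j * \<bar>X s \<omega>\<bar>"
  have int: "integrable (LT \<Otimes>\<^sub>M M) ?f"
    using integrable_norm[OF integrable_power_X[of j]] by (simp add: case_prod_unfold abs_mult power_abs)
  have "(\<integral>s. norm (m j s) \<partial>LT) \<le> (\<integral>s. (\<integral>\<omega>. ?f (s, \<omega>) \<partial>M) \<partial>LT)"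
  proof (rule integral_mono)
    show "integrable LT (\<lambda>s. norm (m j s))" by (intro integrable_norm integrable_m)
    show "integrable LT (\<lambda>s. \<integral>\<omega>. ?f (s, \<omega>) \<partial>M)" by (rule P.integrable_fst'[OF int])
    fix s
    have "norm (m j s) \<le> (\<integral>\<omega>. norm (E j \<omega> * of_real (X s \<omega>)) \<partial>M)"
      unfolding m_def by (rule integral_norm_bound)
    then show "norm (m j s) \<le> (\<integral>\<omega>. ?f (s, \<omega>) \<partial>M)"
      by (simp add: norm_mult norm_E)
  qed
  also have "\<dots> = integral\<^sup>L (LT \<Otimes>\<^sub>M M) ?f" by (rule P.integral_fst'[OF int])
  finally show ?thesis .
qed

text \<open>The cut-off at \<open>t\<close> sits in the integrand so that Fubini is always applied
  on the same product space.\<close>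

definition drift :: "nat \<Rightarrow> real \<Rightarrow> real \<Rightarrow> 'a \<Rightarrow> complex" where
  "drift j t s \<omega> = of_real (indicator {0..t} s) * (of_real (coef \<omega>) * E j \<omega> * of_real (X s \<omega>))"

lemma integrable_time_indicator_mult:
  fixes f :: "real \<times> 'a \<Rightarrow> complex"
  assumes "integrable (LT \<Otimes>\<^sub>M M) f"
  shows "integrable (LT \<Otimes>\<^sub>M M) (\<lambda>(s, \<omega>). of_real (indicator {0..t} s) * f (s, \<omega>))"
proof (rule Bochner_Integration.integrable_bound[OF assms])
  have [measurable]: "(\<lambda>x. indicat_real {0..t} (fst x)) \<in> borel_measurable (LT \<Otimes>\<^sub>M M)"
    using measurable_time_space_fst[of "indicat_real {0..t}"] by (simp add: time_space_def case_prod_unfold)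
  have "(\<lambda>(s, \<omega>). complex_of_real (indicator {0..t} s)) \<in> borel_measurable (LT \<Otimes>\<^sub>M M)"
    unfolding case_prod_unfold by measurable
  then show "(\<lambda>(s, \<omega>). of_real (indicator {0..t} s) * f (s, \<omega>)) \<in> borel_measurable (LT \<Otimes>\<^sub>M M)"
    using borel_measurable_integrable[OF assms] by (simp add: case_prod_unfold)
qed (auto simp: norm_mult indicator_def)

lemma integrable_drift: "integrable (LT \<Otimes>\<^sub>M M) (\<lambda>(s, \<omega>). drift j t s \<omega>)"
proof -
  have "integrable (LT \<Otimes>\<^sub>M M) (\<lambda>x. of_real A * (case x of (s, \<omega>) \<Rightarrow> E j \<omega> * of_real (X s \<omega>)) -
      of_real (c / T) * (case x of (s, \<omega>) \<Rightarrow> E (Suc j) \<omega> * of_real (X s \<omega>)))"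
    by (intro Bochner_Integration.integrable_diff integrable_mult_right integrable_E_X)
  from integrable_time_indicator_mult[OF this, of t] show ?thesis
    by (simp add: drift_def coef_E case_prod_unfold algebra_simps)
qed

lemma integral_drift_time:
  assumes "t \<in> {0..T}"
  shows "(\<integral>s. drift j t s \<omega> \<partial>LT) = E j \<omega> * of_real (LINT s:{0..t}|lborel. coef \<omega> * X s \<omega>)"
proof -
  have "(\<integral>s. drift j t s \<omega> \<partial>LT) = (\<integral>s. E j \<omega> * of_real (indicator {0..t} s * (coef \<omega> * X s \<omega>)) \<partial>LT)"
    by (simp add: drift_def mult_ac)
  also have "\<dots> = E j \<omega> * of_real (\<integral>s. indicator {0..t} s * (coef \<omega> * X s \<omega>) \<partial>LT)"
    unfolding integral_mult_right_zero integral_complex_of_real ..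
  also have "(\<integral>s. indicator {0..t} s * (coef \<omega> * X s \<omega>) \<partial>LT) = (LINT s:{0..t}|lborel. coef \<omega> * X s \<omega>)"
  proof -
    have "(\<integral>s. indicator {0..t} s * (coef \<omega> * X s \<omega>) \<partial>LT) = (LINT s:{0..T}|lborel. indicator {0..t} s * (coef \<omega> * X s \<omega>))"
      unfolding set_lebesgue_integral_def by (rule integral_restrict_space) simp
    moreover have "indicator {0..T} s * (indicator {0..t} s * y) = indicator {0..t} s * y" for s y :: real
      using assms by (auto simp: indicator_def)
    ultimately show ?thesis
      unfolding set_lebesgue_integral_def real_scaleR_def by simp
  qed
  finally show ?thesis .
qed

text \<open>Right-hand side of the moment hierarchy. At \<open>j = 0\<close> the truncated
  \<open>j - 1\<close> is multiplied by zero.\<close>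

definition q :: "nat \<Rightarrow> real \<Rightarrow> complex" where
  "q j s = of_real A * m j s - of_real (c / T) * m (Suc j) s
    + of_real c * of_nat j * m (j - 1) s + \<i> * of_real (c * K s) * m j s"

lemma integrable_q: "integrable LT (q j)"
proof -
  have "integrable LT (\<lambda>s. of_real (K s) * m j s)"
  proof (rule Bochner_Integration.integrable_bound)
    show "integrable LT (\<lambda>s. (\<Sum>i\<le>n. \<bar>k i\<bar>) *\<^sub>R m j s)"
      by (intro integrable_scaleR_right integrable_m)
    have "K \<in> borel_measurable LT" by (rule measurable_restrict_space1) simp
    then show "(\<lambda>s. of_real (K s) * m j s) \<in> borel_measurable LT"
      using borel_measurable_integrable[OF integrable_m[of j]] by measurable
    show "AE s in LT. norm (of_real (K s) * m j s) \<le> norm ((\<Sum>i\<le>n. \<bar>k i\<bar>) *\<^sub>R m j s)"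
      using K_bounded by (intro AE_I2) (auto simp: norm_mult intro!: mult_right_mono abs_ge_self order_trans[OF K_bounded])
  qed
  then have "integrable LT (\<lambda>s. of_real A * m j s - of_real (c / T) * m (Suc j) s
    + of_real c * of_nat j * m (j - 1) s + \<i> * of_real c * (of_real (K s) * m j s))"
    by (intro Bochner_Integration.integrable_diff Bochner_Integration.integrable_add integrable_mult_right integrable_m)
  then show ?thesis by (simp add: q_def[abs_def] mult_ac)
qed

lemma integrable_E: "integrable M (E j)"
  by (rule Bochner_Integration.integrable_bound[OF integrable_power_W_T[of j]])
    (auto simp: norm_E power_abs)

lemma solution_AE:
  "\<exists>Z. \<forall>t\<in>{0..T}. skorokhod_integral M T W (\<lambda>s \<omega>. indicator {0..t} s * (c * X s \<omega>)) (Z t) \<and>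
    (AE \<omega> in M. X t \<omega> = x0 + Z t \<omega> + (LINT s:{0..t}|lborel. coef \<omega> * X s \<omega>))"
proof -
  from solution obtain Z where Z:
    "\<forall>t\<in>{0..T}. skorokhod_integral M T W (\<lambda>s \<omega>. indicator {0..t} s * (c * X s \<omega>)) (Z t)"
    and ae: "AE \<omega> in M. X 0 \<omega> = x0"
      "AE \<omega> in M. \<forall>t\<in>{0..T}. Z t \<omega> = X t \<omega> - X 0 \<omega> - (LINT s:{0..t}|lborel. coef \<omega> * X s \<omega>)"
    unfolding skorokhod_sde_solution_def coef_def by blast
  have "AE \<omega> in M. X t \<omega> = x0 + Z t \<omega> + (LINT s:{0..t}|lborel. coef \<omega> * X s \<omega>)" if "t \<in> {0..T}" for t
    using ae by eventually_elim (use that in auto)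
  with Z show ?thesis by (intro exI[of _ Z] ballI conjI) (rule bspec)
qed

text \<open>The equation improves joint integrability to integrability at each fixed time: the
  constant, the Skorokhod integral and the time integral are each integrable against
  \<open>E j\<close>, hence so is \<open>X t\<close>. Taking expectations, duality evaluates the
  Skorokhod term and Fubini the drift term.\<close>

lemma moment_equation:
  assumes t: "t \<in> {0..T}"
  shows "integrable M (\<lambda>\<omega>. E j \<omega> * of_real (X t \<omega>))"
    and "m j t = of_real x0 * (\<integral>\<omega>. E j \<omega> \<partial>M) + (\<integral>s. of_real (indicator {0..t} s) * q j s \<partial>LT)"
proof -
  obtain Z where sol: "\<forall>t\<in>{0..T}. skorokhod_integral M T W (\<lambda>s \<omega>. indicator {0..t} s * (c * X s \<omega>)) (Z t) \<and>
      (AE \<omega> in M. X t \<omega> = x0 + Z t \<omega> + (LINT s:{0..t}|lborel. coef \<omega> * X s \<omega>))"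
    using solution_AE ..
  note Z = bspec[OF sol, THEN conjunct1] and X_eq = bspec[OF sol, THEN conjunct2]
  have Z_sq: "square_integrable M (Z t)" if "t \<in> {0..T}" for t
    using Z[OF that] unfolding skorokhod_integral_def by (elim conjE)
  have Z_meas: "Z t \<in> borel_measurable M" if "t \<in> {0..T}" for t
    using Z_sq[OF that] unfolding square_integrable_def by (rule conjunct1)
  have int_Z: "integrable M (\<lambda>\<omega>. E j \<omega> * of_real (Z t \<omega>))" if "t \<in> {0..T}" for t j
  proof (rule Bochner_Integration.integrable_bound)
    show "integrable M (\<lambda>\<omega>. W T \<omega> ^ j * Z t \<omega>)"
      using square_integrable_imp_integrable_mult[OF square_integrable_poly[of "monom 1 j"] Z_sq[OF that]]
      by (simp add: poly_monom)
    show "(\<lambda>\<omega>. E j \<omega> * of_real (Z t \<omega>)) \<in> borel_measurable M"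
      using Z_meas[OF that] by measurable
  qed (simp add: norm_mult norm_E abs_mult power_abs)
  have int_drift: "integrable M (\<lambda>\<omega>. \<integral>s. drift j t s \<omega> \<partial>LT)" for t j
    by (rule P.integrable_snd[OF integrable_drift])
  have eq: "AE \<omega> in M. of_real x0 * E j \<omega> + E j \<omega> * of_real (Z t \<omega>) + (\<integral>s. drift j t s \<omega> \<partial>LT) = E j \<omega> * of_real (X t \<omega>)"
    if "t \<in> {0..T}" for t j
    using X_eq[OF that] by eventually_elim (simp add: integral_drift_time[OF that] algebra_simps)
  have int_sum: "integrable M (\<lambda>\<omega>. of_real x0 * E j \<omega> + E j \<omega> * of_real (Z t \<omega>) + (\<integral>s. drift j t s \<omega> \<partial>LT))"
    if "t \<in> {0..T}" for t j
    by (intro Bochner_Integration.integrable_add integrable_mult_right integrable_E int_Z that int_drift)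
  have meas: "(\<lambda>\<omega>. E j \<omega> * of_real (X t \<omega>)) \<in> borel_measurable M" if "t \<in> {0..T}" for t j
    using X_section_measurable[OF that] by measurable
  have int_X: "integrable M (\<lambda>\<omega>. E j \<omega> * of_real (X t \<omega>))" if "t \<in> {0..T}" for t j
    by (rule Bochner_Integration.integrable_cong_AE_imp[OF int_sum[OF that] meas[OF that]])
      (use eq[OF that, of j] in eventually_elim, simp)
  show "integrable M (\<lambda>\<omega>. E j \<omega> * of_real (X t \<omega>))" by (rule int_X[OF t])
  \<comment> \<open>Splitting the expectation at a single time \<open>s\<close> relies on
    \<open>int_X\<close>, which holds at every \<open>s\<close> and not merely at almost every
    one.\<close>
  have drift_m: "(\<integral>\<omega>. drift j t s \<omega> \<partial>M) =
      of_real (indicator {0..t} s) * (of_real A * m j s - of_real (c / T) * m (Suc j) s)"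
    if "s \<in> {0..T}" for s
  proof -
    have "(\<integral>\<omega>. drift j t s \<omega> \<partial>M) = (\<integral>\<omega>. of_real (indicator {0..t} s) *
      (of_real A * (E j \<omega> * of_real (X s \<omega>)) - of_real (c / T) * (E (Suc j) \<omega> * of_real (X s \<omega>))) \<partial>M)"
      by (simp add: drift_def coef_E algebra_simps)
    also have "\<dots> = of_real (indicator {0..t} s) * (of_real A * m j s - of_real (c / T) * m (Suc j) s)"
      by (simp only: integral_mult_right_zero m_def Bochner_Integration.integral_diff
          integrable_mult_right int_X[OF that])
    finally show ?thesis .
  qed
  \<comment> \<open>This is the integrand that \<open>skorokhod_duality\<close> produces for the
    process \<open>c\<close> times \<open>X\<close>, cut off at \<open>t\<close>.\<close>
  define sk where "sk s \<omega> = (of_nat j * E (j - 1) \<omega> + \<i> * of_real (K s) * E j \<omega>) *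
    of_real (indicator {0..t} s * (c * X s \<omega>))" for s \<omega>
  have int_sk: "integrable (LT \<Otimes>\<^sub>M M) (\<lambda>(s, \<omega>). sk s \<omega>)"
  proof -
    have K_int: "integrable (LT \<Otimes>\<^sub>M M) (\<lambda>(s, \<omega>). of_real (K s) * (E j \<omega> * of_real (X s \<omega>)))"
    proof (rule Bochner_Integration.integrable_bound)
      show "integrable (LT \<Otimes>\<^sub>M M) (\<lambda>x. (\<Sum>i\<le>n. \<bar>k i\<bar>) *\<^sub>R (case x of (s, \<omega>) \<Rightarrow> E j \<omega> * of_real (X s \<omega>)))"
        by (intro integrable_scaleR_right integrable_E_X)
      show "(\<lambda>(s, \<omega>). of_real (K s) * (E j \<omega> * of_real (X s \<omega>))) \<in> borel_measurable (LT \<Otimes>\<^sub>M M)"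
        using borel_measurable_integrable[OF integrable_E_X[of j]] K_measurable_time
        unfolding time_space_def case_prod_unfold by measurable
      show "AE x in LT \<Otimes>\<^sub>M M. norm (case x of (s, \<omega>) \<Rightarrow> of_real (K s) * (E j \<omega> * of_real (X s \<omega>))) \<le>
        norm ((\<Sum>i\<le>n. \<bar>k i\<bar>) *\<^sub>R (case x of (s, \<omega>) \<Rightarrow> E j \<omega> * of_real (X s \<omega>)))"
        by (intro AE_I2) (auto simp: norm_mult case_prod_unfold intro!: mult_right_mono order_trans[OF K_bounded])
    qed
    have "integrable (LT \<Otimes>\<^sub>M M) (\<lambda>x. of_real c * of_nat j * (case x of (s, \<omega>) \<Rightarrow> E (j - 1) \<omega> * of_real (X s \<omega>)) +
      \<i> * of_real c * (case x of (s, \<omega>) \<Rightarrow> of_real (K s) * (E j \<omega> * of_real (X s \<omega>))))"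
      by (intro Bochner_Integration.integrable_add integrable_mult_right integrable_E_X K_int)
    from integrable_time_indicator_mult[OF this, of t] show ?thesis
      by (simp add: sk_def case_prod_unfold algebra_simps)
  qed
  have sk_m: "(\<integral>\<omega>. sk s \<omega> \<partial>M) =
      of_real (indicator {0..t} s) * (of_real c * of_nat j * m (j - 1) s + \<i> * of_real (c * K s) * m j s)"
    if "s \<in> {0..T}" for s
  proof -
    have "(\<integral>\<omega>. sk s \<omega> \<partial>M) = (\<integral>\<omega>. of_real (indicator {0..t} s) *
      (of_real c * of_nat j * (E (j - 1) \<omega> * of_real (X s \<omega>)) + \<i> * of_real (c * K s) * (E j \<omega> * of_real (X s \<omega>))) \<partial>M)"
      by (simp add: sk_def algebra_simps)
    also have "\<dots> = of_real (indicator {0..t} s) * (of_real c * of_nat j * m (j - 1) s + \<i> * of_real (c * K s) * m j s)"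
      by (simp only: integral_mult_right_zero m_def Bochner_Integration.integral_add
          integrable_mult_right int_X[OF that])
    finally show ?thesis .
  qed
  have "m j t = (\<integral>\<omega>. of_real x0 * E j \<omega> + E j \<omega> * of_real (Z t \<omega>) + (\<integral>s. drift j t s \<omega> \<partial>LT) \<partial>M)"
    unfolding m_def
    by (rule integral_cong_AE[OF meas[OF t] borel_measurable_integrable[OF int_sum[OF t]]])
      (use eq[OF t, of j] in eventually_elim, simp)
  also have "\<dots> = of_real x0 * (\<integral>\<omega>. E j \<omega> \<partial>M) + (\<integral>\<omega>. E j \<omega> * of_real (Z t \<omega>) \<partial>M) +
      (\<integral>\<omega>. \<integral>s. drift j t s \<omega> \<partial>LT \<partial>M)"
    by (simp only: Bochner_Integration.integral_add[OF Bochner_Integration.integrable_add[OF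
          integrable_mult_right[OF integrable_E] int_Z[OF t]] int_drift]
        Bochner_Integration.integral_add[OF integrable_mult_right[OF integrable_E] int_Z[OF t]]
        integral_mult_right_zero)
  also have "(\<integral>\<omega>. E j \<omega> * of_real (Z t \<omega>) \<partial>M) = (\<integral>(s, \<omega>). sk s \<omega> \<partial>(LT \<Otimes>\<^sub>M M))"
    using skorokhod_duality[OF Z[OF t], of j] by (simp add: sk_def time_space_def)
  also have "\<dots> = (\<integral>s. \<integral>\<omega>. sk s \<omega> \<partial>M \<partial>LT)"
    using P.integral_fst'[OF int_sk] by simp
  also have "(\<integral>\<omega>. \<integral>s. drift j t s \<omega> \<partial>LT \<partial>M) = (\<integral>s. \<integral>\<omega>. drift j t s \<omega> \<partial>M \<partial>LT)"
    using P.integral_snd[OF integrable_drift[of j t]] P.integral_fst'[OF integrable_drift[of j t]] by simp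
  also have "of_real x0 * (\<integral>\<omega>. E j \<omega> \<partial>M) + (\<integral>s. \<integral>\<omega>. sk s \<omega> \<partial>M \<partial>LT) + (\<integral>s. \<integral>\<omega>. drift j t s \<omega> \<partial>M \<partial>LT)
    = of_real x0 * (\<integral>\<omega>. E j \<omega> \<partial>M) + (\<integral>s. (\<integral>\<omega>. sk s \<omega> \<partial>M) + (\<integral>\<omega>. drift j t s \<omega> \<partial>M) \<partial>LT)"
    using P.integrable_fst'[OF int_sk] P.integrable_fst'[OF integrable_drift[of j t]] by simp
  also have "(\<integral>s. (\<integral>\<omega>. sk s \<omega> \<partial>M) + (\<integral>\<omega>. drift j t s \<omega> \<partial>M) \<partial>LT) = (\<integral>s. of_real (indicator {0..t} s) * q j s \<partial>LT)"
    by (rule Bochner_Integration.integral_cong[OF refl])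
      (simp add: space_restrict_space sk_m drift_m q_def algebra_simps)
  finally show "m j t = of_real x0 * (\<integral>\<omega>. E j \<omega> \<partial>M) + (\<integral>s. of_real (indicator {0..t} s) * q j s \<partial>LT)" .
qed

end

section \<open>The truncated generating function along the characteristic\<close>

text \<open>Here \<open>l\<close> is the position on the characteristic and \<open>c / T\<close> its
  speed. After an index shift the terms from the moving \<open>l\<close> cancel the terms in
  \<open>m (Suc j)\<close>, except for \<open>j = N\<close>. The terms in \<open>m (j - 1)\<close>
  shift to \<open>c * l\<close> times the same sum, except for its last summand. These two leftovers
  form the boundary term.\<close>

lemma moment_hierarchy_sum:
  fixes m :: "nat \<Rightarrow> complex" and A c T l K :: complex
  shows "(\<Sum>j\<le>N. (c / T) * (of_nat j * l ^ (j - 1) / fact j) * m j +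
      l ^ j / fact j * (A * m j - (c / T) * m (Suc j) + c * of_nat j * m (j - 1) + \<i> * c * K * m j)) =
    (A + \<i> * c * K + c * l) * (\<Sum>j\<le>N. l ^ j / fact j * m j) -
    l ^ N / fact N * (c * l * m N + (c / T) * m (Suc N))"
proof (induction N)
  case 0
  show ?case by (simp add: algebra_simps)
next
  case (Suc N)
  have 1: "of_nat (Suc N) * l ^ N / fact (Suc N) = l ^ N / fact N"
    by (simp add: field_simps del: of_nat_Suc)
  have 2: "l ^ Suc N / fact (Suc N) * (c * of_nat (Suc N) * m N) = c * l * (l ^ N / fact N) * m N"
    by (simp add: field_simps del: of_nat_Suc)
  show ?case
    unfolding sum.atMost_Suc Suc.IH distrib_left[of "l ^ Suc N / fact (Suc N)"] right_diff_distrib[of "l ^ Suc N / fact (Suc N)"]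
    using 1 2 by (simp add: algebra_simps add_divide_distrib del: power_Suc fact_Suc of_nat_Suc)
qed

text \<open>\<open>P\<close> is the exponent accumulated along the characteristic, and
  \<open>S\<close> collects the possible jump times of \<open>K\<close>, where the moments need not
  be differentiable. After division by exp(P) the truncation changes only through its boundary term,
  whose time integral vanishes in the limit by \<open>decay\<close>. At time 0 the characteristic is
  at \<open>-c\<close> and gives the partial sums of the initial moments; at time \<open>T\<close>
  it is at 0 and, as \<open>0 ^ 0 = 1\<close>, only \<open>m 0 T\<close> remains for every
  \<open>N\<close>.\<close>

theorem moment_hierarchy_limit:
  fixes m :: "nat \<Rightarrow> real \<Rightarrow> complex" and e :: "nat \<Rightarrow> complex" and P :: "real \<Rightarrow> complex"
    and K :: "real \<Rightarrow> real" and A c T :: real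
  defines "q \<equiv> \<lambda>j s. of_real A * m j s - of_real (c / T) * m (Suc j) s
    + of_real c * of_nat j * m (j - 1) s + \<i> * of_real (c * K s) * m j s"
  assumes T: "T > 0" and S: "finite S"
    and m_int: "\<And>j. set_integrable lborel {0..T} (m j)"
    and q_int: "\<And>j. set_integrable lborel {0..T} (q j)"
    and m_eq: "\<And>j t. t \<in> {0..T} \<Longrightarrow> m j t = e j + (LINT s:{0..t}|lborel. q j s)"
    and K_cont: "\<And>t. t \<in> {0<..<T} - S \<Longrightarrow> isCont K t"
    and P_cont: "continuous_on {0..T} P" and P_0: "P 0 = 0"
    and P_deriv: "\<And>t. t \<in> {0<..<T} - S \<Longrightarrow>
      (P has_vector_derivative (of_real A + \<i> * of_real (c * K t) + of_real (c * ((c / T) * (t - T))))) (at t)"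
    and decay: "(\<lambda>N. \<bar>c\<bar> ^ N / fact N * (LINT s:{0..T}|lborel. norm (m N s))) \<longlonglongrightarrow> 0"
      "(\<lambda>N. \<bar>c\<bar> ^ N / fact N * (LINT s:{0..T}|lborel. norm (m (Suc N) s))) \<longlonglongrightarrow> 0"
  shows "(\<lambda>N. \<Sum>j\<le>N. of_real (- c) ^ j / fact j * e j) \<longlonglongrightarrow> exp (- P T) * m 0 T"
proof -
  \<comment> \<open>Passing to the gauge integral gives access to a fundamental theorem of calculus
    that tolerates the finite exceptional set \<open>S\<close>.\<close>
  have q_int': "q j integrable_on {0..T}" for j
    using set_borel_integral_eq_integral(1)[OF q_int] .
  have m_eq': "m j t = e j + integral {0..t} (q j)" if "t \<in> {0..T}" for j t
  proof -
    have "set_integrable lborel {0..t} (q j)"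
      by (rule set_integrable_subset[OF q_int]) (use that in auto)
    from set_borel_integral_eq_integral(2)[OF this] show ?thesis
      using m_eq[OF that] by simp
  qed
  have m_cont: "continuous_on {0..T} (m j)" for j
  proof (subst continuous_on_cong[OF refl m_eq'])
    show "continuous_on {0..T} (\<lambda>t. e j + integral {0..t} (q j))"
      by (intro continuous_intros indefinite_integral_continuous_1 q_int')
  qed
  have m_isCont: "isCont (m j) t" if "t \<in> {0<..<T}" for j t
    using continuous_on_interior[OF m_cont] that by (simp add: interior_atLeastAtMost_real)
  \<comment> \<open>Bootstrapping: every \<open>m j\<close> is continuous as an indefinite integral,
    so \<open>q j\<close>, built from the moments and \<open>K\<close>, is continuous off
    \<open>S\<close>, and the integral equation can be differentiated there.\<close>
  have m_deriv: "(m j has_vector_derivative q j t) (at t)" if t: "t \<in> {0<..<T} - S" for j t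
  proof -
    have "isCont (q j) t"
      unfolding q_def using t by (intro continuous_intros m_isCont K_cont) auto
    then have "((\<lambda>t. integral {0..t} (q j)) has_vector_derivative q j t) (at t within {0..T})"
      using t by (intro integral_has_vector_derivative_continuous_at[where S="{}", simplified] q_int')
        (auto intro: continuous_at_imp_continuous_at_within)
    then have "((\<lambda>t. e j + integral {0..t} (q j)) has_vector_derivative q j t) (at t within {0..T})"
      by (auto intro!: derivative_eq_intros)
    then have "(m j has_vector_derivative q j t) (at t within {0..T})"
      by (rule has_vector_derivative_transform[rotated 2]) (use t m_eq' in auto)
    then show ?thesis
      using t by (subst (asm) at_within_interior) (auto simp: interior_atLeastAtMost_real)
  qed
  \<comment> \<open>\<open>h\<close> truncates the generating function along the characteristic \<open>l\<close>. The sum for \<open>h'\<close>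
    telescopes up to one boundary term, which is what remains in \<open>u'\<close>.\<close>
  define l where "l t = (c / T) * (t - T)" for t
  define h where "h N t = (\<Sum>j\<le>N. of_real (l t ^ j / fact j) * m j t)" for N t
  define u where "u N t = exp (- P t) * h N t" for N t
  define u' where "u' N t = - exp (- P t) * (of_real (l t ^ N / fact N) *
    (of_real (c * l t) * m N t + of_real (c / T) * m (Suc N) t))" for N t
  have l_cont: "continuous_on {0..T} l"
    unfolding l_def by (intro continuous_intros)
  have u_cont: "continuous_on {0..T} (u N)" for N
    unfolding u_def h_def by (intro continuous_intros P_cont m_cont l_cont) auto
  have u_deriv: "(u N has_vector_derivative u' N t) (at t)" if t: "t \<in> {0<..<T} - S" for N t
  proof -
    have l_deriv: "((\<lambda>t. l t ^ j / fact j) has_real_derivative (c / T) * (of_nat j * l t ^ (j - 1) / fact j)) (at t)" for j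
      unfolding l_def using T by (auto intro!: derivative_eq_intros)
    have "(h N has_vector_derivative (\<Sum>j\<le>N. of_real (l t ^ j / fact j) * q j t +
        of_real ((c / T) * (of_nat j * l t ^ (j - 1) / fact j)) * m j t)) (at t)"
      unfolding h_def
      by (intro has_vector_derivative_sum has_vector_derivative_mult m_deriv t
          has_vector_derivative_of_real l_deriv)
    also have "(\<Sum>j\<le>N. of_real (l t ^ j / fact j) * q j t +
        of_real ((c / T) * (of_nat j * l t ^ (j - 1) / fact j)) * m j t) =
      (of_real A + \<i> * of_real (c * K t) + of_real (c * l t)) * h N t -
      of_real (l t ^ N / fact N) * (of_real (c * l t) * m N t + of_real (c / T) * m (Suc N) t)"
      using moment_hierarchy_sum[of "of_real c" "of_real T" "of_real (l t)" "\<lambda>j. m j t" "of_real A" "of_real (K t)" N]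
      by (simp add: h_def q_def algebra_simps)
    finally have h_deriv: "(h N has_vector_derivative
      (of_real A + \<i> * of_real (c * K t) + of_real (c * l t)) * h N t -
      of_real (l t ^ N / fact N) * (of_real (c * l t) * m N t + of_real (c / T) * m (Suc N) t)) (at t)" .
    have "((\<lambda>t. exp (- P t)) has_vector_derivative
      (- (of_real A + \<i> * of_real (c * K t) + of_real (c * l t))) * exp (- P t)) (at t)"
      using field_vector_diff_chain_at[OF has_vector_derivative_minus[OF P_deriv[OF t]] DERIV_exp]
      by (simp add: o_def l_def)
    from has_vector_derivative_mult[OF this h_deriv] show ?thesis
      unfolding u_def u'_def by (simp add: algebra_simps)
  qed
  obtain C where C: "\<And>t. t \<in> {0..T} \<Longrightarrow> norm (exp (- P t)) \<le> C"
  proof -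
    have "compact ((\<lambda>t. exp (- P t)) ` {0..T})"
      by (intro compact_continuous_image continuous_intros P_cont) auto
    then have "bounded ((\<lambda>t. exp (- P t)) ` {0..T})"
      by (rule compact_imp_bounded)
    then obtain C where "\<forall>z\<in>(\<lambda>t. exp (- P t)) ` {0..T}. norm z \<le> C"
      unfolding bounded_iff by (rule exE)
    then show ?thesis by (intro that[of C]) simp
  qed
  have C0: "C \<ge> 0"
    by (rule order_trans[OF norm_ge_zero[of "exp (- P 0)"] C]) (use T in simp)
  define I where "I j = (LINT s:{0..T}|lborel. norm (m j s))" for j
  have nm_int: "(\<lambda>s. norm (m j s)) integrable_on {0..T}" and
    nm_eq: "I j = integral {0..T} (\<lambda>s. norm (m j s))" for j
    using set_borel_integral_eq_integral[OF set_integrable_norm[OF m_int]] by (auto simp: I_def)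
  \<comment> \<open>On \<open>{0..T}\<close> the characteristic stays within
    \<open>\<bar>c\<bar>\<close> of zero, which turns its powers into powers of
    \<open>\<bar>c\<bar>\<close> and the factor \<open>c * l t\<close> into
    \<open>c\<^sup>2\<close>; \<open>C\<close> bounds exp(-P).\<close>
  have bound: "norm (u N T - u N 0) \<le> C * (c\<^sup>2 * (\<bar>c\<bar> ^ N / fact N * I N) + \<bar>c\<bar> / T * (\<bar>c\<bar> ^ N / fact N * I (Suc N)))" for N
  proof -
    define g where "g t = (C * (\<bar>c\<bar> ^ N / fact N) * c\<^sup>2) * norm (m N t) +
      (C * (\<bar>c\<bar> ^ N / fact N) * (\<bar>c\<bar> / T)) * norm (m (Suc N) t)" for t
    have u_int: "(u' N has_integral u N T - u N 0) {0..T}"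
      by (rule fundamental_theorem_of_calculus_interior_strong[OF S]) (use T u_cont u_deriv in auto)
    have g_int: "g integrable_on {0..T}"
      unfolding g_def by (intro integrable_add integrable_on_mult_right nm_int)
    have "norm (integral {0..T} (u' N)) \<le> integral {0..T} g"
    proof (rule integral_norm_bound_integral)
      show "u' N integrable_on {0..T}" using u_int by blast
      fix t assume t: "t \<in> {0..T}"
      have lt: "\<bar>l t\<bar> \<le> \<bar>c\<bar>"
      proof -
        have "\<bar>l t\<bar> = \<bar>c\<bar> * (\<bar>t - T\<bar> / T)" using T by (simp add: l_def abs_mult)
        also have "\<dots> \<le> \<bar>c\<bar> * 1" using t T by (intro mult_left_mono) auto
        finally show ?thesis by simp
      qed
      have "norm (u' N t) = norm (exp (- P t)) * (\<bar>l t\<bar> ^ N / fact N *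
        norm (of_real (c * l t) * m N t + of_real (c / T) * m (Suc N) t))"
        by (simp add: u'_def norm_mult norm_divide norm_power)
      also have "\<dots> \<le> C * (\<bar>c\<bar> ^ N / fact N * (c\<^sup>2 * norm (m N t) + (\<bar>c\<bar> / T) * norm (m (Suc N) t)))"
      proof (intro mult_mono C t divide_right_mono power_mono lt)
        have "norm (of_real (c * l t) * m N t + of_real (c / T) * m (Suc N) t) \<le>
          \<bar>c\<bar> * \<bar>l t\<bar> * norm (m N t) + (\<bar>c\<bar> / T) * norm (m (Suc N) t)"
          by (rule order_trans[OF norm_triangle_ineq]) (use T in \<open>simp add: norm_mult norm_divide\<close>)
        also have "\<dots> \<le> c\<^sup>2 * norm (m N t) + (\<bar>c\<bar> / T) * norm (m (Suc N) t)"
          using mult_left_mono[OF lt, of "\<bar>c\<bar>"] by (intro add_right_mono mult_right_mono) (auto simp: power2_eq_square)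
        finally show "norm (of_real (c * l t) * m N t + of_real (c / T) * m (Suc N) t) \<le>
          c\<^sup>2 * norm (m N t) + (\<bar>c\<bar> / T) * norm (m (Suc N) t)" .
      qed (use C0 in auto)
      also have "\<dots> = g t" by (simp add: g_def algebra_simps)
      finally show "norm (u' N t) \<le> g t" .
    qed (rule g_int)
    also have "integral {0..T} g = C * (c\<^sup>2 * (\<bar>c\<bar> ^ N / fact N * I N) + \<bar>c\<bar> / T * (\<bar>c\<bar> ^ N / fact N * I (Suc N)))"
    proof -
      have "integral {0..T} g = C * (\<bar>c\<bar> ^ N / fact N) * c\<^sup>2 * I N +
        C * (\<bar>c\<bar> ^ N / fact N) * (\<bar>c\<bar> / T) * I (Suc N)"
        unfolding g_def
        by (subst Henstock_Kurzweil_Integration.integral_add[OF integrable_on_mult_right[OF nm_int]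
              integrable_on_mult_right[OF nm_int]]) (simp only: integral_mult_right nm_eq)
      then show ?thesis by (simp add: algebra_simps)
    qed
    finally show ?thesis using integral_unique[OF u_int] by simp
  qed
  have "(\<lambda>N. C * (c\<^sup>2 * (\<bar>c\<bar> ^ N / fact N * I N) + \<bar>c\<bar> / T * (\<bar>c\<bar> ^ N / fact N * I (Suc N)))) \<longlonglongrightarrow>
      C * (c\<^sup>2 * 0 + \<bar>c\<bar> / T * 0)"
    unfolding I_def
    by (rule tendsto_mult_left[OF tendsto_add[OF tendsto_mult_left[OF decay(1)] tendsto_mult_left[OF decay(2)]]])
  then have lim: "(\<lambda>N. C * (c\<^sup>2 * (\<bar>c\<bar> ^ N / fact N * I N) + \<bar>c\<bar> / T * (\<bar>c\<bar> ^ N / fact N * I (Suc N)))) \<longlonglongrightarrow> 0"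
    by simp
  have "(\<lambda>N. u N T - u N 0) \<longlonglongrightarrow> 0"
    by (rule Lim_null_comparison[OF always_eventually lim]) (use bound in blast)
  moreover have "u N T = exp (- P T) * m 0 T" for N
  proof -
    have "h N T = (\<Sum>j\<le>N. if j = 0 then m 0 T else 0)"
      unfolding h_def l_def by (rule sum.cong) auto
    then show ?thesis by (simp add: u_def)
  qed
  moreover have "u N 0 = (\<Sum>j\<le>N. of_real (- c) ^ j / fact j * e j)" for N
  proof -
    have "m j 0 = e j" for j using m_eq'[of 0 j] T by simp
    then show ?thesis using T by (simp add: u_def h_def l_def P_0)
  qed
  ultimately have "(\<lambda>N. exp (- P T) * m 0 T - (exp (- P T) * m 0 T - (\<Sum>j\<le>N. of_real (- c) ^ j / fact j * e j)))
    \<longlonglongrightarrow> exp (- P T) * m 0 T - 0"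
    by (intro tendsto_diff tendsto_const) simp
  then show ?thesis by simp
qed

section \<open>Decay of the boundary term, initial value and terminal moment\<close>

lemma exp_series_sums:
  fixes z :: "'b :: {real_normed_field, banach}"
  shows "(\<lambda>n. z ^ n / fact n) sums exp z"
  using exp_converges[of z] by (simp add: scaleR_conv_of_real divide_inverse mult.commute)

context wiener_space
begin

lemma square_integrable_exp_abs_time:
  "square_integrable (time_space M T) (\<lambda>(s, \<omega>). exp (c * \<bar>W T \<omega>\<bar>))"
proof -
  have eq: "(\<lambda>x. (case x of (s, \<omega>) \<Rightarrow> exp (c * \<bar>W T \<omega>\<bar>))\<^sup>2) = (\<lambda>(s, \<omega>). exp (2 * c * \<bar>W T \<omega>\<bar>))"
    by (auto simp: fun_eq_iff exp_double[symmetric] mult.assoc)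
  show ?thesis
    unfolding square_integrable_def eq
    by (intro conjI integrable_time_space_snd integrable_exp_abs_W_T measurable_time_space_snd) measurable
qed

end

context linear_sde_test
begin

text \<open>For each outcome the factor (|c| |W_T|)^N / N! is a term of a convergent exponential
  series, so it tends to zero. It is at most exp(|c| |W_T|), and the remaining power |W_T|^i is at
  most i! exp(|W_T|); hence the dominating function with rate \<open>\<bar>c\<bar> + 1\<close>,
  integrable because \<open>W T\<close> has all exponential moments and \<open>X\<close> is square
  integrable. The two boundary terms need \<open>i = 0\<close> and \<open>i = 1\<close>.\<close>

lemma moment_decay:
  "(\<lambda>N. \<bar>c\<bar> ^ N / fact N * (LINT s:{0..T}|lborel. norm (m (N + i) s))) \<longlonglongrightarrow> 0"
proof -
  define Y where "Y = (\<lambda>(s, \<omega>). \<bar>X s \<omega>\<bar>)"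
  define w where "w = (\<lambda>(s :: real, \<omega>). \<bar>W T \<omega>\<bar>)"
  have Y_meas[measurable]: "Y \<in> borel_measurable (LT \<Otimes>\<^sub>M M)"
    using X_measurable unfolding Y_def case_prod_unfold by measurable
  have w_meas[measurable]: "w \<in> borel_measurable (LT \<Otimes>\<^sub>M M)"
    using measurable_time_space_snd[of "\<lambda>\<omega>. \<bar>W T \<omega>\<bar>"] unfolding w_def time_space_def by simp
  have nn: "w x \<ge> 0" "Y x \<ge> 0" for x
    by (auto simp: w_def Y_def split: prod.split)
  have "integrable (LT \<Otimes>\<^sub>M M) (\<lambda>x. exp ((\<bar>c\<bar> + 1) * w x) * Y x)"
    using integrable_abs[OF square_integrable_imp_integrable_mult[OF square_integrable_exp_abs_time[of "\<bar>c\<bar> + 1"] square_integrable_X]]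
    by (simp add: time_space_def case_prod_unfold w_def Y_def abs_mult)
  then have dom: "integrable (LT \<Otimes>\<^sub>M M) (\<lambda>x. fact i * (exp ((\<bar>c\<bar> + 1) * w x) * Y x))"
    by (rule integrable_mult_right)
  have "(\<lambda>N. \<integral>x. (\<bar>c\<bar> * w x) ^ N / fact N * (w x ^ i * Y x) \<partial>(LT \<Otimes>\<^sub>M M)) \<longlonglongrightarrow> (\<integral>x. 0 \<partial>(LT \<Otimes>\<^sub>M M))"
  proof (rule integral_dominated_convergence[OF _ _ dom])
    show "AE x in LT \<Otimes>\<^sub>M M. (\<lambda>N. (\<bar>c\<bar> * w x) ^ N / fact N * (w x ^ i * Y x)) \<longlonglongrightarrow> 0"
      by (intro AE_I2 tendsto_mult_left_zero summable_LIMSEQ_zero sums_summable[OF exp_series_sums])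
    fix N
    show "AE x in LT \<Otimes>\<^sub>M M. norm ((\<bar>c\<bar> * w x) ^ N / fact N * (w x ^ i * Y x)) \<le>
      fact i * (exp ((\<bar>c\<bar> + 1) * w x) * Y x)"
    proof (rule AE_I2)
      fix x
      have "(\<bar>c\<bar> * w x) ^ N / fact N * w x ^ i \<le> exp (\<bar>c\<bar> * w x) * (fact i * exp (w x))"
        using power_le_fact_exp[of "\<bar>c\<bar> * w x" N] power_le_fact_exp[of "w x" i] nn
        by (intro mult_mono) (auto simp: divide_simps mult.commute)
      also have "\<dots> = fact i * exp ((\<bar>c\<bar> + 1) * w x)"
        by (simp add: exp_add[symmetric] algebra_simps)
      finally have "(\<bar>c\<bar> * w x) ^ N / fact N * w x ^ i * Y x \<le> fact i * exp ((\<bar>c\<bar> + 1) * w x) * Y x"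
        using nn by (intro mult_right_mono) auto
      then show "norm ((\<bar>c\<bar> * w x) ^ N / fact N * (w x ^ i * Y x)) \<le>
        fact i * (exp ((\<bar>c\<bar> + 1) * w x) * Y x)"
        using nn by (simp add: abs_mult mult.assoc)
    qed
  qed measurable
  then have lim: "(\<lambda>N. \<integral>x. (\<bar>c\<bar> * w x) ^ N / fact N * (w x ^ i * Y x) \<partial>(LT \<Otimes>\<^sub>M M)) \<longlonglongrightarrow> 0"
    by simp
  show ?thesis
  proof (rule Lim_null_comparison[OF always_eventually lim], rule allI)
    fix N
    have "(LINT s:{0..T}|lborel. norm (m (N + i) s)) = (\<integral>s. norm (m (N + i) s) \<partial>LT)"
      unfolding set_lebesgue_integral_def by (rule integral_restrict_space[symmetric]) simp
    also have "\<dots> \<le> (\<integral>x. w x ^ (N + i) * Y x \<partial>(LT \<Otimes>\<^sub>M M))"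
      using norm_m_le[of "N + i"] by (simp add: w_def Y_def case_prod_unfold)
    finally have "\<bar>c\<bar> ^ N / fact N * (LINT s:{0..T}|lborel. norm (m (N + i) s)) \<le>
      \<bar>c\<bar> ^ N / fact N * (\<integral>x. w x ^ (N + i) * Y x \<partial>(LT \<Otimes>\<^sub>M M))"
      by (intro mult_left_mono) auto
    also have "\<dots> = (\<integral>x. \<bar>c\<bar> ^ N / fact N * (w x ^ (N + i) * Y x) \<partial>(LT \<Otimes>\<^sub>M M))"
      by (rule integral_mult_right_zero[symmetric])
    also have "\<dots> = (\<integral>x. (\<bar>c\<bar> * w x) ^ N / fact N * (w x ^ i * Y x) \<partial>(LT \<Otimes>\<^sub>M M))"
      by (simp add: power_mult_distrib power_add mult_ac)
    finally have "\<bar>c\<bar> ^ N / fact N * (LINT s:{0..T}|lborel. norm (m (N + i) s)) \<le> \<dots>" .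
    moreover have "(LINT s:{0..T}|lborel. norm (m (N + i) s)) \<ge> 0"
      unfolding set_lebesgue_integral_def by (intro Bochner_Integration.integral_nonneg) simp
    ultimately show "norm (\<bar>c\<bar> ^ N / fact N * (LINT s:{0..T}|lborel. norm (m (N + i) s))) \<le>
      (\<integral>x. (\<bar>c\<bar> * w x) ^ N / fact N * (w x ^ i * Y x) \<partial>(LT \<Otimes>\<^sub>M M))"
      by (simp add: abs_mult)
  qed
qed

text \<open>This evaluates the initial generating function at the starting point \<open>-c\<close>.
  The partial sums of the exponential series are dominated by exp(|c| |W_T|), which is
  integrable.\<close>

lemma E_series_tendsto:
  "(\<lambda>N. \<Sum>j\<le>N. of_real (- c) ^ j / fact j * (\<integral>\<omega>. E j \<omega> \<partial>M)) \<longlonglongrightarrow>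
    (\<integral>\<omega>. of_real (exp (- c * W T \<omega>)) * cis (L \<omega>) \<partial>M)"
proof -
  have eq: "(\<Sum>j\<le>N. of_real (- c) ^ j / fact j * (\<integral>\<omega>. E j \<omega> \<partial>M)) =
    (\<integral>\<omega>. of_real (\<Sum>j\<le>N. (- c * W T \<omega>) ^ j / fact j) * cis (L \<omega>) \<partial>M)" for N
  proof -
    have "(\<Sum>j\<le>N. of_real (- c) ^ j / fact j * (\<integral>\<omega>. E j \<omega> \<partial>M)) =
      (\<integral>\<omega>. (\<Sum>j\<le>N. of_real (- c) ^ j / fact j * E j \<omega>) \<partial>M)"
      by (simp only: Bochner_Integration.integral_sum[OF integrable_mult_right[OF integrable_E]]
          integral_mult_right_zero)
    also have "\<dots> = (\<integral>\<omega>. of_real (\<Sum>j\<le>N. (- c * W T \<omega>) ^ j / fact j) * cis (L \<omega>) \<partial>M)"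
      unfolding E_def power_mult_distrib of_real_sum sum_distrib_right
      by (intro Bochner_Integration.integral_cong sum.cong refl) simp
    finally show ?thesis .
  qed
  have [measurable]: "(\<lambda>\<omega>. cis (L \<omega>)) \<in> borel_measurable M"
    unfolding cis_conv_exp by measurable
  show ?thesis
    unfolding eq
  proof (rule integral_dominated_convergence[OF _ _ integrable_exp_abs_W_T[of "\<bar>c\<bar>"]])
    have "(\<lambda>N. \<Sum>j\<le>N. (- c * W T \<omega>) ^ j / fact j) \<longlonglongrightarrow> exp (- c * W T \<omega>)" for \<omega>
      using exp_series_sums[of "- c * W T \<omega>"] by (simp only: sums_def_le)
    then show "AE \<omega> in M. (\<lambda>N. of_real (\<Sum>j\<le>N. (- c * W T \<omega>) ^ j / fact j) * cis (L \<omega>)) \<longlonglongrightarrow>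
      of_real (exp (- c * W T \<omega>)) * cis (L \<omega>)"
      by (intro AE_I2 tendsto_mult tendsto_of_real tendsto_const)
    fix N
    show "AE \<omega> in M. norm (of_real (\<Sum>j\<le>N. (- c * W T \<omega>) ^ j / fact j) * cis (L \<omega>)) \<le> exp (\<bar>c\<bar> * \<bar>W T \<omega>\<bar>)"
    proof (rule AE_I2)
      fix \<omega>
      have "\<bar>\<Sum>j\<le>N. (- c * W T \<omega>) ^ j / fact j\<bar> \<le> (\<Sum>j\<le>N. (\<bar>c\<bar> * \<bar>W T \<omega>\<bar>) ^ j / fact j)"
        by (rule order_trans[OF sum_abs]) (simp add: power_abs abs_mult)
      also have "\<dots> \<le> (\<Sum>j. (\<bar>c\<bar> * \<bar>W T \<omega>\<bar>) ^ j / fact j)"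
        by (rule sum_le_suminf) (auto intro: sums_summable[OF exp_series_sums])
      also have "\<dots> = exp (\<bar>c\<bar> * \<bar>W T \<omega>\<bar>)"
        by (rule sums_unique[symmetric, OF exp_series_sums])
      finally show "norm (of_real (\<Sum>j\<le>N. (- c * W T \<omega>) ^ j / fact j) * cis (L \<omega>)) \<le> exp (\<bar>c\<bar> * \<bar>W T \<omega>\<bar>)"
        by (simp only: norm_mult norm_of_real norm_cis mult_1_right)
    qed
  qed measurable
qed

lemma isCont_K:
  assumes t: "t \<in> {0<..<T} - \<tau> ` {..n}"
  shows "isCont K t"
  unfolding K_def[abs_def]
proof (intro continuous_intros)
  fix i assume "i \<in> {..n}"
  then have "\<tau> i \<noteq> t" "0 < t" "\<tau> i \<ge> 0" using t tau_range[of i] by auto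
  then show "isCont (indicator {0..\<tau> i} :: real \<Rightarrow> real) t"
    unfolding isCont_indicator by (auto simp: frontier_def interior_atLeastAtMost_real)
qed

lemma terminal_moment:
  "m 0 T = exp (of_real (A * T - c\<^sup>2 * T / 2) + \<i> * of_real (c * (\<Sum>i\<le>n. k i * \<tau> i))) *
    (of_real x0 * (\<integral>\<omega>. of_real (exp (- c * W T \<omega>)) * cis (L \<omega>) \<partial>M))"
proof -
  \<comment> \<open>The antiderivative, vanishing at 0, of the growth rate on the characteristic:
    the quadratic part integrates \<open>c * ((c / T) * (t - T))\<close>, and
    \<open>min t (\<tau> i)\<close> integrates the indicator of \<open>{0..\<tau> i}\<close>. At
    \<open>T\<close> the quadratic part equals \<open>- (c\<^sup>2 * T / 2)\<close>.\<close>
  define P where "P t = complex_of_real (A * t + c * (c / T) * (t\<^sup>2 / 2 - t * T)) +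
    \<i> * of_real (c * (\<Sum>i\<le>n. k i * min t (\<tau> i)))" for t
  have lim: "(\<lambda>N. \<Sum>j\<le>N. of_real (- c) ^ j / fact j * (of_real x0 * (\<integral>\<omega>. E j \<omega> \<partial>M))) \<longlonglongrightarrow> exp (- P T) * m 0 T"
  proof (rule moment_hierarchy_limit[where S = "\<tau> ` {..n}" and K = K and A = A and c = c
        and T = T and P = P and m = m and e = "\<lambda>j. of_real x0 * (\<integral>\<omega>. E j \<omega> \<partial>M)"])
    show "T > 0" by (rule T_pos)
    show "set_integrable lborel {0..T} (m j)" for j
      using integrable_m[of j] unfolding set_integrable_def by (subst (asm) integrable_restrict_space) auto
    show "set_integrable lborel {0..T} (\<lambda>s. of_real A * m j s - of_real (c / T) * m (Suc j) s
      + of_real c * of_nat j * m (j - 1) s + \<i> * of_real (c * K s) * m j s)" for j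
      using integrable_q[of j] unfolding set_integrable_def q_def[abs_def]
      by (subst (asm) integrable_restrict_space) auto
    show "m j t = of_real x0 * (\<integral>\<omega>. E j \<omega> \<partial>M) + (LINT s:{0..t}|lborel. of_real A * m j s - of_real (c / T) * m (Suc j) s
      + of_real c * of_nat j * m (j - 1) s + \<i> * of_real (c * K s) * m j s)" if t: "t \<in> {0..T}" for j t
    proof -
      have "(\<integral>s. of_real (indicator {0..t} s) * q j s \<partial>LT) = (\<integral>s. indicator {0..T} s *\<^sub>R (of_real (indicator {0..t} s) * q j s) \<partial>lborel)"
        by (rule integral_restrict_space) simp
      also have "\<dots> = (LINT s:{0..t}|lborel. q j s)"
        unfolding set_lebesgue_integral_def
        by (rule Bochner_Integration.integral_cong) (use t in \<open>auto simp: indicator_def\<close>)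
      finally show ?thesis using moment_equation(2)[OF t, of j] by (simp add: q_def[abs_def])
    qed
    show "continuous_on {0..T} P"
      unfolding P_def by (intro continuous_intros) auto
    show "P 0 = 0"
      using tau_range by (auto simp: P_def min_def intro!: sum.neutral)
    fix t assume t: "t \<in> {0<..<T} - \<tau> ` {..n}"
    then show "isCont K t" by (rule isCont_K)
    \<comment> \<open>Away from \<open>\<tau> i\<close> the minimum is locally the identity or
      locally constant.\<close>
    have "((\<lambda>t. k i * min t (\<tau> i)) has_real_derivative k i * indicator {0..\<tau> i} t) (at t)" if "i \<le> n" for i
    proof (cases "t < \<tau> i")
      case True
      have "((\<lambda>t. k i * t) has_real_derivative k i * indicator {0..\<tau> i} t) (at t)"
        using True t by (auto intro!: derivative_eq_intros)
      then show ?thesis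
        by (rule DERIV_cong_ev[THEN iffD1, OF refl _ refl, rotated])
          (use True in \<open>auto intro: eventually_mono[OF order_tendstoD(2)[OF tendsto_ident_at]]
            eventually_nhds_in_open[of "{..<\<tau> i}", THEN eventually_mono]\<close>)
    next
      case False
      then have "t > \<tau> i" using t that by force
      have "((\<lambda>t. k i * \<tau> i) has_real_derivative k i * indicator {0..\<tau> i} t) (at t)"
        using \<open>t > \<tau> i\<close> by (auto intro!: derivative_eq_intros)
      then show ?thesis
        by (rule DERIV_cong_ev[THEN iffD1, OF refl _ refl, rotated])
          (use \<open>t > \<tau> i\<close> in \<open>auto intro: eventually_nhds_in_open[of "{\<tau> i<..}", THEN eventually_mono]\<close>)
    qed
    then have "((\<lambda>t. \<Sum>i\<le>n. k i * min t (\<tau> i)) has_real_derivative K t) (at t)"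
      unfolding K_def by (intro DERIV_sum) auto
    then have d1: "((\<lambda>t. c * (\<Sum>i\<le>n. k i * min t (\<tau> i))) has_real_derivative c * K t) (at t)"
      by (rule DERIV_cmult)
    have d2: "((\<lambda>t. A * t + c * (c / T) * (t\<^sup>2 / 2 - t * T)) has_real_derivative (A + c * ((c / T) * (t - T)))) (at t)"
      using T_pos by (auto intro!: derivative_eq_intros)
    have "(P has_vector_derivative (of_real (A + c * ((c / T) * (t - T))) + \<i> * of_real (c * K t))) (at t)"
      unfolding P_def
      by (intro has_vector_derivative_add has_vector_derivative_of_real d2 has_vector_derivative_mult_right d1)
    then show "(P has_vector_derivative (of_real A + \<i> * of_real (c * K t) + of_real (c * ((c / T) * (t - T))))) (at t)"
      by (simp add: algebra_simps)
  next
    show "(\<lambda>N. \<bar>c\<bar> ^ N / fact N * (LINT s:{0..T}|lborel. norm (m N s))) \<longlonglongrightarrow> 0"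
      using moment_decay[of 0] by simp
    show "(\<lambda>N. \<bar>c\<bar> ^ N / fact N * (LINT s:{0..T}|lborel. norm (m (Suc N) s))) \<longlonglongrightarrow> 0"
      using moment_decay[of 1] by simp
  qed auto
  have "(\<lambda>N. \<Sum>j\<le>N. of_real (- c) ^ j / fact j * (of_real x0 * (\<integral>\<omega>. E j \<omega> \<partial>M))) =
    (\<lambda>N. of_real x0 * (\<Sum>j\<le>N. of_real (- c) ^ j / fact j * (\<integral>\<omega>. E j \<omega> \<partial>M)))"
    by (simp add: sum_distrib_left mult_ac)
  then have "exp (- P T) * m 0 T = of_real x0 * (\<integral>\<omega>. of_real (exp (- c * W T \<omega>)) * cis (L \<omega>) \<partial>M)"
    using LIMSEQ_unique[OF lim] tendsto_mult_left[OF E_series_tendsto, of "of_real x0"] by simp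
  moreover have "m 0 T = exp (P T) * (exp (- P T) * m 0 T)"
    by (simp add: exp_minus)
  ultimately have "m 0 T = exp (P T) * (of_real x0 * (\<integral>\<omega>. of_real (exp (- c * W T \<omega>)) * cis (L \<omega>) \<partial>M))"
    by (simp only:)
  moreover have "P T = of_real (A * T - c\<^sup>2 * T / 2) + \<i> * of_real (c * (\<Sum>i\<le>n. k i * \<tau> i))"
  proof -
    have "min T (\<tau> i) = \<tau> i" if "i \<le> n" for i using tau_range[OF that] by simp
    then have "(\<Sum>i\<le>n. k i * min T (\<tau> i)) = (\<Sum>i\<le>n. k i * \<tau> i)" by simp
    moreover have "c * (c / T) * (T\<^sup>2 / 2 - T * T) = - (c\<^sup>2 * T / 2)"
      using T_pos by (simp add: field_simps power2_eq_square)
    ultimately show ?thesis by (simp only: P_def diff_conv_add_uminus)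
  qed
  ultimately show ?thesis by simp
qed

end

section \<open>Exponential tilting of Gaussian increments\<close>

text \<open>Completing the square: tilting by \<open>a\<close> shifts the mean by \<open>a\<close>
  times the variance.\<close>

lemma normal_density_exp_tilt:
  assumes "\<sigma> > 0"
  shows "normal_density 0 \<sigma> x * exp (a * x) = exp (a\<^sup>2 * \<sigma>\<^sup>2 / 2) * normal_density 0 \<sigma> (x - a * \<sigma>\<^sup>2)"
proof -
  have "- x\<^sup>2 / (2 * \<sigma>\<^sup>2) + a * x = a\<^sup>2 * \<sigma>\<^sup>2 / 2 + (- (x - a * \<sigma>\<^sup>2)\<^sup>2 / (2 * \<sigma>\<^sup>2))"
    using assms by (simp add: field_simps power2_eq_square)
  then show ?thesis by (simp add: normal_density_def exp_add[symmetric])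
qed

text \<open>Translating the variable by the shift of the mean produces the phase. The Gaussian
  characteristic function stays unevaluated, since it appears on both sides; thus real translations
  suffice and no complex shift of the contour is made.\<close>

lemma normal_integral_exp_cis:
  assumes s: "\<sigma> > 0"
  shows "(\<integral>x. of_real (normal_density 0 \<sigma> x * exp (a * x)) * cis (v * x) \<partial>lborel) =
    of_real (exp (a\<^sup>2 * \<sigma>\<^sup>2 / 2)) * cis (a * v * \<sigma>\<^sup>2) * (\<integral>x. of_real (normal_density 0 \<sigma> x) * cis (v * x) \<partial>lborel)"
proof -
  have "(\<integral>x. of_real (normal_density 0 \<sigma> x * exp (a * x)) * cis (v * x) \<partial>lborel) =
    (\<integral>x. of_real (normal_density 0 \<sigma> (a * \<sigma>\<^sup>2 + x) * exp (a * (a * \<sigma>\<^sup>2 + x))) * cis (v * (a * \<sigma>\<^sup>2 + x)) \<partial>lborel)"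
    using lborel_integral_real_affine[of 1 _ "a * \<sigma>\<^sup>2"] by simp
  also have "\<dots> = (\<integral>x. of_real (exp (a\<^sup>2 * \<sigma>\<^sup>2 / 2)) * cis (a * v * \<sigma>\<^sup>2) * (of_real (normal_density 0 \<sigma> x) * cis (v * x)) \<partial>lborel)"
  proof (rule Bochner_Integration.integral_cong[OF refl])
    fix x
    have "cis (v * (a * \<sigma>\<^sup>2 + x)) = cis (a * v * \<sigma>\<^sup>2) * cis (v * x)"
      by (simp add: cis_mult algebra_simps)
    moreover have "normal_density 0 \<sigma> (a * \<sigma>\<^sup>2 + x) * exp (a * (a * \<sigma>\<^sup>2 + x)) =
        exp (a\<^sup>2 * \<sigma>\<^sup>2 / 2) * normal_density 0 \<sigma> x"
      using normal_density_exp_tilt[OF s, of "a * \<sigma>\<^sup>2 + x" a] by simp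
    ultimately show "of_real (normal_density 0 \<sigma> (a * \<sigma>\<^sup>2 + x) * exp (a * (a * \<sigma>\<^sup>2 + x))) * cis (v * (a * \<sigma>\<^sup>2 + x)) =
      of_real (exp (a\<^sup>2 * \<sigma>\<^sup>2 / 2)) * cis (a * v * \<sigma>\<^sup>2) * (of_real (normal_density 0 \<sigma> x) * cis (v * x))"
      by simp
  qed
  finally show ?thesis by simp
qed

text \<open>Each increment is counted once for every later index, so its coefficient is a tail sum
  of \<open>k\<close>. This rewrites a combination of values of \<open>W\<close> in terms of
  independent increments, and likewise for the times themselves.\<close>

lemma summation_by_parts_increments:
  fixes k x :: "nat \<Rightarrow> real"
  shows "(\<Sum>i\<le>n. k i * (x i - x 0)) = (\<Sum>j<n. (\<Sum>i\<in>{Suc j..n}. k i) * (x (Suc j) - x j))"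
proof (induction n)
  case (Suc n)
  have "(\<Sum>j<Suc n. (\<Sum>i\<in>{Suc j..Suc n}. k i) * (x (Suc j) - x j)) =
    (\<Sum>j<Suc n. (\<Sum>i\<in>{Suc j..n}. k i) * (x (Suc j) - x j) + k (Suc n) * (x (Suc j) - x j))"
    by (rule sum.cong) (auto simp: algebra_simps)
  also have "\<dots> = (\<Sum>j<n. (\<Sum>i\<in>{Suc j..n}. k i) * (x (Suc j) - x j)) + k (Suc n) * (\<Sum>j<Suc n. x (Suc j) - x j)"
    unfolding sum.distrib sum_distrib_left by simp
  finally show ?case using Suc by (simp add: sum_lessThan_telescope)
qed simp

context wiener_space
begin

lemma increment_integral_exp_cis:
  assumes "0 \<le> s" "s \<le> t" "t \<le> T"
  shows "integrable M (\<lambda>\<omega>. of_real (exp (a * (W t \<omega> - W s \<omega>))) * cis (v * (W t \<omega> - W s \<omega>)))"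
    and "(\<integral>\<omega>. of_real (exp (a * (W t \<omega> - W s \<omega>))) * cis (v * (W t \<omega> - W s \<omega>)) \<partial>M) =
      of_real (exp (a\<^sup>2 * (t - s) / 2)) * cis (a * v * (t - s)) * (\<integral>\<omega>. cis (v * (W t \<omega> - W s \<omega>)) \<partial>M)"
proof -
  have "integrable M (\<lambda>\<omega>. of_real (exp (a * (W t \<omega> - W s \<omega>))) * cis (v * (W t \<omega> - W s \<omega>))) \<and>
    (\<integral>\<omega>. of_real (exp (a * (W t \<omega> - W s \<omega>))) * cis (v * (W t \<omega> - W s \<omega>)) \<partial>M) =
      of_real (exp (a\<^sup>2 * (t - s) / 2)) * cis (a * v * (t - s)) * (\<integral>\<omega>. cis (v * (W t \<omega> - W s \<omega>)) \<partial>M)"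
  \<comment> \<open>\<open>W_normal\<close> covers only \<open>s < t\<close>; for equal times the
    increment is zero and both integrals are one. Repeated grid times thus cause no trouble.\<close>
  proof (cases "s = t")
    case True
    then show ?thesis by simp
  next
    case False
    then have st: "s < t" using assms by simp
    define D where "D \<omega> = W t \<omega> - W s \<omega>" for \<omega>
    have [measurable]: "D \<in> borel_measurable M"
      unfolding D_def using assms by (intro borel_measurable_diff W_measurable) auto
    have dist: "distributed M lborel D (normal_density 0 (sqrt (t - s)))"
      unfolding D_def using W_normal[of s t] assms st by simp
    have cm[measurable]: "(\<lambda>x. cis (v * x)) \<in> borel_measurable borel"
      unfolding cis_conv_exp by measurable
    have tr: "(\<integral>\<omega>. g (D \<omega>) \<partial>M) = (\<integral>x. of_real (normal_density 0 (sqrt (t - s)) x) * g x \<partial>lborel)"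
      if [measurable]: "g \<in> borel_measurable borel" for g :: "real \<Rightarrow> complex"
    proof -
      have "(\<integral>\<omega>. g (D \<omega>) \<partial>M) = (\<integral>x. g x \<partial>distr M lborel D)"
        by (rule integral_distr[symmetric]) auto
      also have "\<dots> = (\<integral>x. g x \<partial>density lborel (normal_density 0 (sqrt (t - s))))"
        using distributed_distr_eq_density[OF dist] by simp
      also have "\<dots> = (\<integral>x. normal_density 0 (sqrt (t - s)) x *\<^sub>R g x \<partial>lborel)"
        by (rule integral_density) auto
      finally show ?thesis by (simp add: scaleR_conv_of_real)
    qed
    have "integrable M (\<lambda>\<omega>. exp (a * D \<omega>))"
      using integrable_normal_exp[of "sqrt (t - s)" 0 a] st
        distributed_integrable[OF dist, of "\<lambda>x. exp (a * x)"] by auto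
    then have int: "integrable M (\<lambda>\<omega>. of_real (exp (a * D \<omega>)) * cis (v * D \<omega>))"
      by (rule Bochner_Integration.integrable_bound) (auto simp: norm_mult)
    have "(\<integral>\<omega>. of_real (exp (a * D \<omega>)) * cis (v * D \<omega>) \<partial>M) =
      (\<integral>x. of_real (normal_density 0 (sqrt (t - s)) x * exp (a * x)) * cis (v * x) \<partial>lborel)"
      by (subst tr) (auto simp: mult.assoc)
    also have "\<dots> = of_real (exp (a\<^sup>2 * (t - s) / 2)) * cis (a * v * (t - s)) *
      (\<integral>x. of_real (normal_density 0 (sqrt (t - s)) x) * cis (v * x) \<partial>lborel)"
      using st by (subst normal_integral_exp_cis) auto
    also have "(\<integral>x. of_real (normal_density 0 (sqrt (t - s)) x) * cis (v * x) \<partial>lborel) = (\<integral>\<omega>. cis (v * D \<omega>) \<partial>M)"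
      by (subst tr) auto
    finally show ?thesis using int by (simp add: D_def)
  qed
  then show "integrable M (\<lambda>\<omega>. of_real (exp (a * (W t \<omega> - W s \<omega>))) * cis (v * (W t \<omega> - W s \<omega>)))"
    and "(\<integral>\<omega>. of_real (exp (a * (W t \<omega> - W s \<omega>))) * cis (v * (W t \<omega> - W s \<omega>)) \<partial>M) =
      of_real (exp (a\<^sup>2 * (t - s) / 2)) * cis (a * v * (t - s)) * (\<integral>\<omega>. cis (v * (W t \<omega> - W s \<omega>)) \<partial>M)"
    by blast+
qed

end

text \<open>Independence factorises the expectation over the increments, and each factor is tilted
  separately. The variances add up to \<open>T\<close>, and summation by parts, applied to
  \<open>\<tau>\<close> instead of \<open>W\<close>, collects the phases. This is the Cameron-Martin
  shift of \<open>W t\<close> by \<open>a * t\<close>, seen on trigonometric functions.\<close>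

lemma (in trig_test) cameron_martin_trig:
  assumes mono: "mono_on {..n} \<tau>" and tau_0: "\<tau> 0 = 0"
  shows "(\<integral>\<omega>. of_real (exp (a * W T \<omega>)) * cis (L \<omega>) \<partial>M) =
    of_real (exp (a\<^sup>2 * T / 2)) * cis (a * (\<Sum>i\<le>n. k i * \<tau> i)) * (\<integral>\<omega>. cis (L \<omega>) \<partial>M)"
proof -
  define v where "v j = (\<Sum>i\<in>{Suc j..n}. k i)" for j
  define D where "D j \<omega> = W (\<tau> (Suc j)) \<omega> - W (\<tau> j) \<omega>" for j \<omega>
  have tau: "0 \<le> \<tau> j" "\<tau> j \<le> \<tau> (Suc j)" "\<tau> (Suc j) \<le> T" if "j < n" for j
    using tau_range[of j] tau_range[of "Suc j"] mono_onD[OF mono, of j "Suc j"] that by auto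
  have L_eq: "AE \<omega> in M. L \<omega> = (\<Sum>j<n. v j * D j \<omega>)"
    using W_start
  proof eventually_elim
    case (elim \<omega>)
    have "L \<omega> = (\<Sum>i\<le>n. k i * (W (\<tau> i) \<omega> - W (\<tau> 0) \<omega>))"
      by (simp add: L_def tau_0 elim)
    then show ?case
      using summation_by_parts_increments[of k "\<lambda>i. W (\<tau> i) \<omega>" n] by (simp add: v_def D_def)
  qed
  have W_eq: "AE \<omega> in M. W T \<omega> = (\<Sum>j<n. D j \<omega>)"
    using W_start
  proof eventually_elim
    case (elim \<omega>)
    have "(\<Sum>j<n. D j \<omega>) = W (\<tau> n) \<omega> - W (\<tau> 0) \<omega>"
      unfolding D_def by (rule sum_lessThan_telescope)
    then show ?case by (simp add: tau_0 tau_last elim)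
  qed
  have cis_sum: "cis (\<Sum>j<n. f j) = (\<Prod>j<n. cis (f j))" for f :: "nat \<Rightarrow> real"
    by (induction n) (simp_all add: cis_mult[symmetric])
  have [measurable]: "(\<lambda>x. cis (w * x)) \<in> borel_measurable borel" for w
    unfolding cis_conv_exp by measurable
  have [measurable]: "(\<lambda>\<omega>. cis (L \<omega>)) \<in> borel_measurable M"
    unfolding cis_conv_exp by measurable
  have D_meas: "D j \<in> borel_measurable M" if "j < n" for j
    unfolding D_def using tau[OF that] by (intro borel_measurable_diff W_measurable) auto
  have indep: "indep_vars (\<lambda>_. borel) D {..<n}"
    unfolding D_def using tau_range mono by (intro W_indep_increments) auto
  define f where "f a j x = complex_of_real (exp (a * x)) * cis (v j * x)" for a j x
  have f_int: "integrable M (\<lambda>\<omega>. f a j (D j \<omega>))" if "j < n" for a j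
    unfolding f_def D_def by (intro increment_integral_exp_cis tau[OF that])
  have prod_eq: "(\<integral>\<omega>. of_real (exp (a * W T \<omega>)) * cis (L \<omega>) \<partial>M) = (\<Prod>j<n. \<integral>\<omega>. f a j (D j \<omega>) \<partial>M)" for a
  proof -
    have "(\<integral>\<omega>. of_real (exp (a * W T \<omega>)) * cis (L \<omega>) \<partial>M) = (\<integral>\<omega>. (\<Prod>j<n. f a j (D j \<omega>)) \<partial>M)"
    proof (rule integral_cong_AE)
      show "(\<lambda>\<omega>. \<Prod>j<n. f a j (D j \<omega>)) \<in> borel_measurable M"
        using f_int by (intro borel_measurable_prod borel_measurable_integrable) auto
      show "AE \<omega> in M. of_real (exp (a * W T \<omega>)) * cis (L \<omega>) = (\<Prod>j<n. f a j (D j \<omega>))"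
        using L_eq W_eq
      proof eventually_elim
        case (elim \<omega>)
        show ?case
          unfolding elim by (simp add: f_def prod.distrib cis_sum exp_sum sum_distrib_left)
      qed
    qed measurable
    also have "\<dots> = (\<Prod>j<n. \<integral>\<omega>. f a j (D j \<omega>) \<partial>M)"
    proof (rule indep_vars_lebesgue_integral)
      show "indep_vars (\<lambda>_. borel) (\<lambda>j \<omega>. f a j (D j \<omega>)) {..<n}"
        by (rule indep_vars_compose2[OF indep]) (simp add: f_def)
    qed (use f_int in auto)
    finally show ?thesis .
  qed
  have step: "(\<integral>\<omega>. f a j (D j \<omega>) \<partial>M) =
    of_real (exp (a\<^sup>2 * (\<tau> (Suc j) - \<tau> j) / 2)) * cis (a * v j * (\<tau> (Suc j) - \<tau> j)) * (\<integral>\<omega>. f 0 j (D j \<omega>) \<partial>M)"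
    if "j < n" for j
    using increment_integral_exp_cis(2)[OF tau[OF that], of a "v j"] by (simp add: f_def D_def)
  have "(\<integral>\<omega>. of_real (exp (a * W T \<omega>)) * cis (L \<omega>) \<partial>M) =
    (\<Prod>j<n. of_real (exp (a\<^sup>2 * (\<tau> (Suc j) - \<tau> j) / 2))) * (\<Prod>j<n. cis (a * v j * (\<tau> (Suc j) - \<tau> j))) *
    (\<Prod>j<n. \<integral>\<omega>. f 0 j (D j \<omega>) \<partial>M)"
    unfolding prod_eq prod.distrib[symmetric] by (rule prod.cong) (auto simp: step)
  \<comment> \<open>The untilted factors are reassembled by the same factorisation, read backwards
    with \<open>a = 0\<close>.\<close>
  also have "(\<Prod>j<n. \<integral>\<omega>. f 0 j (D j \<omega>) \<partial>M) = (\<integral>\<omega>. cis (L \<omega>) \<partial>M)"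
    using prod_eq[of 0] by simp
  also have "(\<Prod>j<n. cis (a * v j * (\<tau> (Suc j) - \<tau> j))) = cis (a * (\<Sum>i\<le>n. k i * \<tau> i))"
  proof -
    have "(\<Sum>i\<le>n. k i * \<tau> i) = (\<Sum>j<n. v j * (\<tau> (Suc j) - \<tau> j))"
      using summation_by_parts_increments[of k \<tau> n] tau_0 by (simp add: v_def)
    then show ?thesis
      by (simp only: cis_sum[symmetric] sum_distrib_left mult.assoc)
  qed
  also have "(\<Prod>j<n. complex_of_real (exp (a\<^sup>2 * (\<tau> (Suc j) - \<tau> j) / 2))) = of_real (exp (a\<^sup>2 * T / 2))"
  proof -
    have "(\<Prod>j<n. complex_of_real (exp (a\<^sup>2 * (\<tau> (Suc j) - \<tau> j) / 2))) =
      of_real (exp (\<Sum>j<n. a\<^sup>2 / 2 * (\<tau> (Suc j) - \<tau> j)))"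
      by (simp add: exp_sum)
    also have "(\<Sum>j<n. a\<^sup>2 / 2 * (\<tau> (Suc j) - \<tau> j)) = a\<^sup>2 / 2 * (\<tau> n - \<tau> 0)"
      by (simp only: sum_distrib_left[symmetric] sum_lessThan_telescope)
    finally show ?thesis by (simp add: tau_0 tau_last)
  qed
  finally show ?thesis .
qed

section \<open>The terminal value\<close>

text \<open>The product exp(-A t) f(t) has derivative zero, so it keeps its initial value
  \<open>x0\<close>.\<close>

lemma linear_integral_equation:
  fixes f :: "real \<Rightarrow> real"
  assumes T: "T > 0" and cont: "continuous_on {0..T} f"
    and eq: "\<And>t. t \<in> {0..T} \<Longrightarrow> f t = x0 + A * integral {0..t} f"
  shows "f T = x0 * exp (A * T)"
proof -
  have deriv: "((\<lambda>t. exp (- A * t) * f t) has_real_derivative 0) (at t within {0..T})" if t: "t \<in> {0..T}" for t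
  proof -
    have "((\<lambda>t. integral {0..t} f) has_real_derivative f t) (at t within {0..T})"
      using integral_has_vector_derivative[OF cont t] by (simp add: has_real_derivative_iff_has_vector_derivative)
    then have "((\<lambda>t. x0 + A * integral {0..t} f) has_real_derivative A * f t) (at t within {0..T})"
      by (auto intro!: derivative_eq_intros)
    then have "(f has_real_derivative A * f t) (at t within {0..T})"
      by (rule has_field_derivative_transform_within[OF _ zero_less_one t]) (use eq in auto)
    then show ?thesis
      by (auto intro!: derivative_eq_intros)
  qed
  obtain C where C: "\<And>t. t \<in> {0..T} \<Longrightarrow> exp (- A * t) * f t = C"
    using has_field_derivative_zero_constant[OF convex_real_interval(5) deriv] by blast
  have "exp (- A * T) * f T = exp (- A * 0) * f 0"
    using C[of 0] C[of T] T by simp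
  also have "\<dots> = x0" using eq[of 0] T by simp
  finally show ?thesis by (simp add: exp_minus field_simps)
qed

text \<open>The Cameron-Martin factor for \<open>a = - c\<close> is the inverse of the quadratic and
  phase parts of the transport exponent in \<open>terminal_moment\<close>, so only exp(A T)
  survives.\<close>

lemma (in linear_sde_test) terminal_moment_eq:
  assumes "mono_on {..n} \<tau>" "\<tau> 0 = 0"
  shows "(\<integral>\<omega>. cis (L \<omega>) * of_real (X T \<omega>) \<partial>M) = of_real (x0 * exp (A * T)) * (\<integral>\<omega>. cis (L \<omega>) \<partial>M)"
proof -
  let ?S = "\<Sum>i\<le>n. k i * \<tau> i"
  have "(\<integral>\<omega>. cis (L \<omega>) * of_real (X T \<omega>) \<partial>M) = m 0 T"
    by (simp add: m_def E_def)
  also have "\<dots> = exp (of_real (A * T - c\<^sup>2 * T / 2) + \<i> * of_real (c * ?S)) *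
    (of_real x0 * (of_real (exp (c\<^sup>2 * T / 2)) * cis (- c * ?S) * (\<integral>\<omega>. cis (L \<omega>) \<partial>M)))"
    unfolding terminal_moment cameron_martin_trig[OF assms] by simp
  also have "exp (of_real (A * T - c\<^sup>2 * T / 2) + \<i> * of_real (c * ?S)) =
      of_real (exp (A * T - c\<^sup>2 * T / 2)) * cis (c * ?S)"
    by (simp only: exp_add exp_of_real cis_conv_exp)
  also have "\<dots> * (of_real x0 * (of_real (exp (c\<^sup>2 * T / 2)) * cis (- c * ?S) * (\<integral>\<omega>. cis (L \<omega>) \<partial>M))) =
    of_real x0 * of_real (exp (A * T - c\<^sup>2 * T / 2) * exp (c\<^sup>2 * T / 2)) * (cis (c * ?S) * cis (- c * ?S)) * (\<integral>\<omega>. cis (L \<omega>) \<partial>M)"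
    by (simp only: of_real_mult mult_ac)
  also have "\<dots> = of_real (x0 * exp (A * T)) * (\<integral>\<omega>. cis (L \<omega>) \<partial>M)"
    by (simp add: cis_mult flip: exp_add)
  finally show ?thesis .
qed

section \<open>Identification of the terminal value from its moments\<close>

context wiener_space
begin

text \<open>The set \<open>I\<close>, enlarged by 0 and \<open>T\<close>, is sorted into an
  increasing grid as the tilting argument requires; grid points outside \<open>I\<close> get
  coefficient zero.\<close>

lemma grid_representation:
  fixes k :: "real \<Rightarrow> real"
  assumes I: "finite I" "I \<subseteq> {0..T}"
  obtains n \<tau> k' where "trig_test M T W n \<tau>" "mono_on {..n} \<tau>" "\<tau> 0 = 0"
    "\<And>\<omega>. trig_test.L W n \<tau> k' \<omega> = (\<Sum>t\<in>I. k t * W t \<omega>)"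
proof -
  define ts where "ts = sorted_list_of_set (I \<union> {0, T})"
  define n where "n = length ts - 1"
  define k' where "k' i = (if ts ! i \<in> I then k (ts ! i) else 0)" for i
  have fin: "finite (I \<union> {0, T})" using I by simp
  have set_ts: "set ts = I \<union> {0, T}" and sorted: "sorted ts" and dist: "distinct ts"
    unfolding ts_def
    by (rule set_sorted_list_of_set[OF fin] sorted_sorted_list_of_set distinct_sorted_list_of_set)+
  have len: "length ts = Suc n"
    using set_ts by (cases ts) (auto simp: n_def)
  have range: "ts ! i \<in> {0..T}" if "i \<le> n" for i
  proof -
    have "ts ! i \<in> set ts" using that len by (intro nth_mem) simp
    then show ?thesis using set_ts I T_pos by auto
  qed
  have mono: "mono_on {..n} (\<lambda>i. ts ! i)"
    using sorted len by (intro mono_onI sorted_nth_mono) auto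
  have first: "ts ! 0 = 0"
  proof -
    obtain i where i: "i < length ts" "ts ! i = 0"
      using set_ts by (metis UnI2 in_set_conv_nth insertI1)
    then have "ts ! 0 \<le> 0" using sorted_nth_mono[OF sorted, of 0 i] by simp
    then show ?thesis using range[of 0] by simp
  qed
  have last: "ts ! n = T"
  proof -
    obtain i where i: "i < length ts" "ts ! i = T"
      using set_ts by (metis UnI2 in_set_conv_nth insertI1 insert_commute)
    then have "T \<le> ts ! n" using sorted_nth_mono[OF sorted, of i n] len by simp
    then show ?thesis using range[of n] by simp
  qed
  have tt: "trig_test M T W n (\<lambda>i. ts ! i)"
    by unfold_locales (use range last in auto)
  have "trig_test.L W n (\<lambda>i. ts ! i) k' \<omega> = (\<Sum>t\<in>I. k t * W t \<omega>)" for \<omega>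
  proof -
    have "trig_test.L W n (\<lambda>i. ts ! i) k' \<omega> = (\<Sum>i\<in>{..<length ts}. (if ts ! i \<in> I then k (ts ! i) else 0) * W (ts ! i) \<omega>)"
      by (simp add: trig_test.L_def[OF tt] k'_def len lessThan_Suc_atMost)
    also have "\<dots> = (\<Sum>t\<in>set ts. (if t \<in> I then k t else 0) * W t \<omega>)"
      by (rule sum.reindex_bij_betw[OF bij_betw_nth[OF dist refl refl]])
    also have "\<dots> = (\<Sum>t\<in>I. k t * W t \<omega>)"
      using I by (intro sum.mono_neutral_cong_right) (auto simp: set_ts)
    finally show ?thesis .
  qed
  then show ?thesis using that tt mono first by blast
qed

lemma linear_sde_terminal_nonzero:
  assumes sol: "skorokhod_sde_solution M T W x0 (\<lambda>\<omega>. A - c / T * W T \<omega>) c X" and c: "c \<noteq> 0"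
  shows "AE \<omega> in M. X T \<omega> = x0 * exp (A * T)"
proof -
  have int: "integrable M (X T)"
  proof -
    \<comment> \<open>With all frequencies zero, \<open>E 0\<close> is identically one, so
      \<open>moment_equation\<close> yields the integrability of \<open>X T\<close> itself.\<close>
    obtain n \<tau> k' where grid: "trig_test M T W n \<tau>" "mono_on {..n} \<tau>" "\<tau> 0 = 0"
      and "\<And>\<omega>. trig_test.L W n \<tau> k' \<omega> = (\<Sum>t\<in>{}. 0 * W t \<omega>)"
      using grid_representation[OF finite.emptyI empty_subsetI, of "\<lambda>_. 0"] by metis
    interpret trig_test M T W n \<tau> "\<lambda>_. 0" by (rule grid(1))
    interpret linear_sde_test M T W n \<tau> "\<lambda>_. 0" X x0 A c
      by unfold_locales (use sol c in auto)
    have "integrable M (\<lambda>\<omega>. norm (E 0 \<omega> * of_real (X T \<omega>)))"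
      using T_pos by (intro integrable_norm moment_equation(1)) simp
    then show ?thesis
      using T_pos by (intro integrable_norm_cancel[of _ "X T"] X_section_measurable) (simp_all add: norm_mult norm_E)
  qed
  define y where "y = x0 * exp (A * T)"
  have "AE \<omega> in M. X T \<omega> - y = 0"
  proof (rule trig_orthogonal_imp_AE_zero)
    show "integrable M (\<lambda>\<omega>. X T \<omega> - y)" using int by simp
    fix I k assume I: "finite I" "I \<subseteq> {0..T}"
    obtain n \<tau> k' where grid: "trig_test M T W n \<tau>" "mono_on {..n} \<tau>" "\<tau> 0 = 0"
      and L_eq: "\<And>\<omega>. trig_test.L W n \<tau> k' \<omega> = (\<Sum>t\<in>I. k t * W t \<omega>)"
      using grid_representation[OF I, of k] by metis
    interpret trig_test M T W n \<tau> k' by (rule grid(1))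
    interpret linear_sde_test M T W n \<tau> k' X x0 A c
      by unfold_locales (use sol c in auto)
    have cis_int: "integrable M (\<lambda>\<omega>. cis (L \<omega>))"
      using integrable_E[of 0] by (simp add: E_def[abs_def])
    have int': "integrable M (\<lambda>\<omega>. cis (L \<omega>) * of_real (X T \<omega>))"
      using moment_equation(1)[of T 0] T_pos by (simp add: E_def)
    have "(\<integral>\<omega>. of_real (X T \<omega> - y) * cis (\<Sum>t\<in>I. k t * W t \<omega>) \<partial>M) =
      (\<integral>\<omega>. cis (L \<omega>) * of_real (X T \<omega>) - of_real y * cis (L \<omega>) \<partial>M)"
      by (simp add: L_eq algebra_simps)
    also have "\<dots> = (\<integral>\<omega>. cis (L \<omega>) * of_real (X T \<omega>) \<partial>M) - of_real y * (\<integral>\<omega>. cis (L \<omega>) \<partial>M)"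
      using int' cis_int by simp
    also have "\<dots> = 0"
      using terminal_moment_eq[OF grid(2,3)] by (simp add: y_def)
    finally show "(\<integral>\<omega>. of_real (X T \<omega> - y) * cis (\<Sum>t\<in>I. k t * W t \<omega>) \<partial>M) = 0" .
  qed
  then show ?thesis by (simp add: y_def)
qed

text \<open>Duality with the zero process makes \<open>Z\<close> orthogonal to every exp(iL), and
  these variables are total.\<close>

lemma skorokhod_integral_zero:
  assumes sk: "skorokhod_integral M T W (\<lambda>s \<omega>. 0) Z"
  shows "AE \<omega> in M. Z \<omega> = 0"
proof (rule trig_orthogonal_imp_AE_zero)
  have sq: "square_integrable M Z"
    using sk unfolding skorokhod_integral_def by (elim conjE)
  have "square_integrable M (\<lambda>_. 1)" by (simp add: square_integrable_def)
  from square_integrable_imp_integrable_mult[OF sq this] show "integrable M Z" by simp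
  fix I k assume I: "finite I" "I \<subseteq> {0..T}"
  obtain n \<tau> k' where grid: "trig_test M T W n \<tau>" "mono_on {..n} \<tau>" "\<tau> 0 = 0"
    and L_eq: "\<And>\<omega>. trig_test.L W n \<tau> k' \<omega> = (\<Sum>t\<in>I. k t * W t \<omega>)"
    using grid_representation[OF I, of k] by metis
  interpret trig_test M T W n \<tau> k' by (rule grid(1))
  show "(\<integral>\<omega>. of_real (Z \<omega>) * cis (\<Sum>t\<in>I. k t * W t \<omega>) \<partial>M) = 0"
    using skorokhod_duality[OF sk, of 0] by (simp add: E_def L_eq mult.commute case_prod_unfold)
qed

text \<open>The null set outside which \<open>Z t\<close> vanishes depends on \<open>t\<close>, so
  the pathwise equation is obtained by Fubini and only at almost every time. Its right-hand side is
  continuous in time and agrees with the path almost everywhere, hence satisfies the linear integral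
  equation at every time. That the path takes this value at \<open>T\<close> is added from the
  equation at that fixed time.\<close>

lemma linear_sde_terminal_zero:
  assumes sol: "skorokhod_sde_solution M T W x0 (\<lambda>\<omega>. A) 0 X"
  shows "AE \<omega> in M. X T \<omega> = x0 * exp (A * T)"
proof -
  let ?LT = "restrict_space lborel {0..T}"
  interpret P: pair_sigma_finite ?LT M by (rule pair_sigma_finite_time)
  have X_meas[measurable]: "(\<lambda>(s, \<omega>). X s \<omega>) \<in> borel_measurable (?LT \<Otimes>\<^sub>M M)"
    using sol unfolding skorokhod_sde_solution_def time_space_def by (elim conjE)
  have X0: "AE \<omega> in M. X 0 \<omega> = x0"
    using sol unfolding skorokhod_sde_solution_def by (elim conjE)
  have X_int: "AE \<omega> in M. set_integrable lborel {0..T} (\<lambda>s. A * X s \<omega>)"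
    using sol unfolding skorokhod_sde_solution_def by (elim conjE)
  obtain Z where Z: "\<forall>t\<in>{0..T}. skorokhod_integral M T W (\<lambda>s \<omega>. indicator {0..t} s * (0 * X s \<omega>)) (Z t)"
    and Z_eq: "AE \<omega> in M. \<forall>t\<in>{0..T}. Z t \<omega> = X t \<omega> - X 0 \<omega> - (LINT s:{0..t}|lborel. A * X s \<omega>)"
    using sol unfolding skorokhod_sde_solution_def by blast
  have Z0: "AE \<omega> in M. Z t \<omega> = 0" if "t \<in> {0..T}" for t
    using bspec[OF Z that] by (intro skorokhod_integral_zero) simp
  \<comment> \<open>Integrating over a fixed measure with \<open>s\<close> inside the integrand
    makes \<open>J\<close> jointly measurable, as the exchange of the two almost-everywhere
    quantifiers requires.\<close>
  define J where "J s \<omega> = (\<integral>u. indicator {0..s} u * X u \<omega> \<partial>?LT)" for s \<omega>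
  have J_eq: "A * J s \<omega> = (LINT u:{0..s}|lborel. A * X u \<omega>)" if "s \<in> {0..T}" for s \<omega>
  proof -
    have "J s \<omega> = (\<integral>u. indicator {0..T} u *\<^sub>R (indicator {0..s} u * X u \<omega>) \<partial>lborel)"
      unfolding J_def by (rule integral_restrict_space) simp
    also have "\<dots> = (\<integral>u. indicator {0..s} u * X u \<omega> \<partial>lborel)"
      by (rule Bochner_Integration.integral_cong) (use that in \<open>auto simp: indicator_def\<close>)
    finally show ?thesis by (simp add: set_lebesgue_integral_def mult.left_commute)
  qed
  have pointwise: "AE \<omega> in M. X t \<omega> = x0 + A * J t \<omega>" if t: "t \<in> {0..T}" for t
    using Z0[OF t] Z_eq X0 by eventually_elim (use t in \<open>simp add: J_eq\<close>)
  have J_meas: "(\<lambda>x. J (fst x) (snd x)) \<in> borel_measurable (?LT \<Otimes>\<^sub>M M)"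
  proof -
    have "(\<lambda>y. indicator {0..fst (fst y)} (snd y) * X (snd y) (snd (fst y)))
      \<in> borel_measurable ((?LT \<Otimes>\<^sub>M M) \<Otimes>\<^sub>M ?LT)"
    proof (rule borel_measurable_times)
      have [measurable]: "(\<lambda>x. x) \<in> borel_measurable ?LT"
        by (rule measurable_restrict_space1) simp
      have "(\<lambda>y. if 0 \<le> snd y \<and> snd y \<le> fst (fst y) then 1 else (0 :: real)) \<in> borel_measurable ((?LT \<Otimes>\<^sub>M M) \<Otimes>\<^sub>M ?LT)"
        by measurable
      then show "(\<lambda>y. indicator {0..fst (fst y)} (snd y) :: real) \<in> borel_measurable ((?LT \<Otimes>\<^sub>M M) \<Otimes>\<^sub>M ?LT)"
        by (simp add: indicator_def of_bool_def)
      have "(\<lambda>y. (snd y, snd (fst y))) \<in> (?LT \<Otimes>\<^sub>M M) \<Otimes>\<^sub>M ?LT \<rightarrow>\<^sub>M ?LT \<Otimes>\<^sub>M M"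
        by measurable
      from measurable_compose[OF this X_meas]
      show "(\<lambda>y. X (snd y) (snd (fst y))) \<in> borel_measurable ((?LT \<Otimes>\<^sub>M M) \<Otimes>\<^sub>M ?LT)"
        by simp
    qed
    then show ?thesis
      unfolding J_def by (intro P.M1.borel_measurable_lebesgue_integral) (simp add: case_prod_unfold)
  qed
  have "AE s in ?LT. AE \<omega> in M. X s \<omega> = x0 + A * J s \<omega>"
    by (rule AE_I2) (use pointwise in \<open>simp add: space_restrict_space\<close>)
  also have "?this \<longleftrightarrow> (AE \<omega> in M. AE s in ?LT. X s \<omega> = x0 + A * J s \<omega>)"
  proof (rule P.AE_commute)
    show "{x \<in> space (?LT \<Otimes>\<^sub>M M). X (fst x) (snd x) = x0 + A * J (fst x) (snd x)} \<in> sets (?LT \<Otimes>\<^sub>M M)"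
      using X_meas J_meas unfolding case_prod_unfold by measurable
  qed
  finally have ae: "AE \<omega> in M. AE s in ?LT. X s \<omega> = x0 + A * J s \<omega>" .
  show ?thesis
  \<comment> \<open>For \<open>A = 0\<close> the integrability condition of the equation says
    nothing about \<open>X\<close>, but then the integral term is zero.\<close>
  proof (cases "A = 0")
    case True
    show ?thesis using pointwise[of T] T_pos True by simp
  next
    case False
    have "AE \<omega> in M. X T \<omega> = x0 + A * J T \<omega>" using T_pos by (intro pointwise) simp
    with ae X_int show ?thesis
    proof eventually_elim
      case (elim \<omega>)
      have X_set: "set_integrable lborel {0..T} (\<lambda>s. X s \<omega>)"
        using elim(2) False by simp
      have J_int: "J t \<omega> = integral {0..t} (\<lambda>s. X s \<omega>)" if t: "t \<in> {0..T}" for t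
      proof -
        have "set_integrable lborel {0..t} (\<lambda>s. X s \<omega>)"
          by (rule set_integrable_subset[OF X_set]) (use t in auto)
        from set_borel_integral_eq_integral(2)[OF this] J_eq[OF t, of \<omega>] False
        show ?thesis by simp
      qed
      \<comment> \<open>The continuous modification of the path: replacing the path by
        \<open>f\<close> under the integral changes only a negligible set of times.\<close>
      define f where "f t = x0 + A * J t \<omega>" for t
      have "continuous_on {0..T} (\<lambda>t. x0 + A * integral {0..t} (\<lambda>s. X s \<omega>))"
        by (intro continuous_intros indefinite_integral_continuous_1
            set_borel_integral_eq_integral(1)[OF X_set])
      then have f_cont: "continuous_on {0..T} f"
        by (rule continuous_on_eq) (simp add: f_def J_int)
      from elim(1) have "AE s in lborel. s \<in> {0..T} \<longrightarrow> X s \<omega> = f s"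
        unfolding f_def by (subst (asm) AE_restrict_space_iff) auto
      then obtain N where N: "N \<in> null_sets lborel" "\<And>s. s \<in> {0..T} \<Longrightarrow> s \<notin> N \<Longrightarrow> X s \<omega> = f s"
        unfolding eventually_ae_filter by (auto simp: subset_eq)
      have "negligible N"
        using N(1) by (simp add: negligible_iff_null_sets null_sets_completionI)
      have "f T = x0 * exp (A * T)"
      proof (rule linear_integral_equation[OF T_pos f_cont])
        fix t assume t: "t \<in> {0..T}"
        have "integral {0..t} (\<lambda>s. X s \<omega>) = integral {0..t} f"
          by (rule integral_spike[OF \<open>negligible N\<close>]) (use N(2) t in auto)
        then show "f t = x0 + A * integral {0..t} f"
          using t by (simp add: f_def J_int)
      qed
      then show ?case using elim(3) by (simp add: f_def)
    qed
  qed
qed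

lemma linear_sde_terminal:
  assumes "skorokhod_sde_solution M T W x0 (\<lambda>\<omega>. A - c / T * W T \<omega>) c X"
  shows "AE \<omega> in M. X T \<omega> = x0 * exp (A * T)"
  using assms linear_sde_terminal_nonzero linear_sde_terminal_zero by (cases "c = 0") auto

section \<open>The wealth equation and the optimal portfolio\<close>

lemma wealth_terminal:
  assumes sol: "wealth_solution M T W \<mu> r \<sigma> b x0 p X"
  shows "AE \<omega> in M. X T \<omega> = x0 * exp (r * T + (\<mu> - r) * p * T + \<sigma> * b * p)"
proof -
  \<comment> \<open>The coefficient of \<open>W T\<close> in the drift is minus the diffusion
    coefficient over \<open>T\<close>, exactly the form for which the terminal value is
    deterministic; the constant part absorbs \<open>b\<close>.\<close>
  have "(\<lambda>\<omega>. (1 - p) * r + p * \<mu> + p * \<sigma> * ((b - W T \<omega>) / T)) =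
    (\<lambda>\<omega>. ((1 - p) * r + p * \<mu> + p * \<sigma> * b / T) - p * \<sigma> / T * W T \<omega>)"
    by (simp add: fun_eq_iff diff_divide_distrib algebra_simps)
  with sol have "AE \<omega> in M. X T \<omega> = x0 * exp (((1 - p) * r + p * \<mu> + p * \<sigma> * b / T) * T)"
    by (intro linear_sde_terminal) (simp add: wealth_solution_def)
  moreover have "((1 - p) * r + p * \<mu> + p * \<sigma> * b / T) * T = r * T + (\<mu> - r) * p * T + \<sigma> * b * p"
    using T_pos by (simp add: field_simps)
  ultimately show ?thesis by (simp only:)
qed

text \<open>The ratio is almost surely the exponential of a constant. Positivity and integrability
  ensure that the value is a genuine expected logarithm and not a default value of \<open>ln\<close>
  or of the integral.\<close>

lemma wealth_log_return:
  assumes sol: "wealth_solution M T W \<mu> r \<sigma> b x0 p X" and x0: "x0 > 0"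
  shows "AE \<omega> in M. X T \<omega> / X 0 \<omega> > 0"
    and "integrable M (\<lambda>\<omega>. ln (X T \<omega> / X 0 \<omega>))"
    and "(\<integral>\<omega>. ln (X T \<omega> / X 0 \<omega>) \<partial>M) = r * T + (\<mu> - r) * p * T + \<sigma> * b * p"
proof -
  let ?v = "r * T + (\<mu> - r) * p * T + \<sigma> * b * p"
  have X_meas: "(\<lambda>(s, \<omega>). X s \<omega>) \<in> borel_measurable (restrict_space lborel {0..T} \<Otimes>\<^sub>M M)"
    using sol unfolding wealth_solution_def skorokhod_sde_solution_def time_space_def by (elim conjE)
  have X0: "AE \<omega> in M. X 0 \<omega> = x0"
    using sol unfolding wealth_solution_def skorokhod_sde_solution_def by (elim conjE)
  have X_section: "X s \<in> borel_measurable M" if "s \<in> {0..T}" for s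
    using measurable_compose[OF measurable_Pair1' X_meas, of s] that by (simp add: space_restrict_space)
  have [measurable]: "X 0 \<in> borel_measurable M" "X T \<in> borel_measurable M"
    using T_pos by (auto intro: X_section)
  have ratio: "AE \<omega> in M. X T \<omega> / X 0 \<omega> = exp ?v"
    using wealth_terminal[OF sol] X0 by eventually_elim (use x0 in simp)
  then show "AE \<omega> in M. X T \<omega> / X 0 \<omega> > 0" by eventually_elim simp
  have ln: "AE \<omega> in M. ln (X T \<omega> / X 0 \<omega>) = ?v"
    using ratio by eventually_elim simp
  show "integrable M (\<lambda>\<omega>. ln (X T \<omega> / X 0 \<omega>))"
    by (subst integrable_cong_AE[OF _ _ ln]) auto
  have "(\<integral>\<omega>. ln (X T \<omega> / X 0 \<omega>) \<partial>M) = (\<integral>\<omega>. ?v \<partial>M)"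
    by (rule integral_cong_AE[OF _ _ ln]) auto
  then show "(\<integral>\<omega>. ln (X T \<omega> / X 0 \<omega>) \<partial>M) = ?v" by (simp add: prob_space)
qed

end

theorem mainTheorem2:
  fixes M :: "'a measure" and W :: "real \<Rightarrow> 'a \<Rightarrow> real"
    and T \<sigma> \<mu> r b \<theta> x0 p_star :: real
    and X :: "real \<Rightarrow> real \<Rightarrow> 'a \<Rightarrow> real" and V :: "real \<Rightarrow> real"
  assumes wiener: "wiener_space M T W"
    and T_pos: "T > 0" and sigma_pos: "\<sigma> > 0" and x0_pos: "x0 > 0"
    and theta_def: "\<theta> = (\<mu> - r) / \<sigma>"
    and X_solution: "\<And>p. wealth_solution M T W \<mu> r \<sigma> b x0 p (X p)"
    and V_def: "\<And>p. V p = (\<integral>\<omega>. ln (X p T \<omega> / X p 0 \<omega>) \<partial>M)"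
    and p_star_def: "p_star = of_bool (b > - \<theta> * T)"
  shows "(\<forall>p. (AE \<omega> in M. X p T \<omega> / X p 0 \<omega> > 0) \<and>
              integrable M (\<lambda>\<omega>. ln (X p T \<omega> / X p 0 \<omega>)) \<and>
              V p = r * T + (\<mu> - r) * p * T + \<sigma> * b * p) \<and>
         is_arg_max V (\<lambda>p. p \<in> {0..1}) p_star \<and>
         V p_star = r * T + (\<theta> * \<sigma> * T + \<sigma> * b) * of_bool (b > - \<theta> * T)"
proof -
  note log_return = wiener_space.wealth_log_return[OF wiener X_solution x0_pos]
  have V: "V p = r * T + (\<mu> - r) * p * T + \<sigma> * b * p" for p
    unfolding V_def by (rule log_return(3))
  \<comment> \<open>Since \<open>\<mu> - r = \<theta> * \<sigma>\<close>, the value is affine in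
    \<open>p\<close>, and its slope has the sign of \<open>\<theta> * T + b\<close>. The maximum
    over \<open>{0..1}\<close> is thus at 1 for positive slope and at 0 otherwise; zero slope makes
    all portfolios equal, and \<open>of_bool\<close> selects 0.\<close>
  have V': "V p = r * T + \<sigma> * (\<theta> * T + b) * p" for p
    using sigma_pos by (simp add: V theta_def field_simps)
  have "is_arg_max V (\<lambda>p. p \<in> {0..1}) p_star"
    unfolding is_arg_max_def
  proof (intro conjI notI)
    show "p_star \<in> {0..1}" by (simp add: p_star_def)
    assume "\<exists>p. p \<in> {0..1} \<and> V p_star < V p"
    then obtain p where p: "0 \<le> p" "p \<le> 1" and less: "V p_star < V p" by auto
    show False
    proof (cases "b > - \<theta> * T")
      case True
      then have "\<sigma> * (\<theta> * T + b) * p \<le> \<sigma> * (\<theta> * T + b) * 1"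
        using p sigma_pos by (intro mult_left_mono) auto
      then show False using less True by (simp add: V' p_star_def)
    next
      case False
      then have "\<sigma> * (\<theta> * T + b) * p \<le> 0"
        using p sigma_pos by (intro mult_nonpos_nonneg mult_nonneg_nonpos) auto
      then show False using less False by (simp add: V' p_star_def)
    qed
  qed
  moreover have "V p_star = r * T + (\<theta> * \<sigma> * T + \<sigma> * b) * of_bool (b > - \<theta> * T)"
    by (simp add: V' p_star_def algebra_simps)
  ultimately show ?thesis using log_return(1,2) V by blast
qed

end
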